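(* Consider estimating a scale mixture of normals density $q(y-\mu)$, $y\in\mathbb{R}^p$, with $q\sim SN_p(H)$, under integrated $L_2$ loss, based on $X\sim p_X(x-\mu)$ with $p_X\sim SN_p(G)$, $\mu\in\mathbb{R}^p$. Let $W_1,W_2\sim H$ and $V_1\sim G$ be independently distributed, and let $F$ and $J$ be the cdfs of $V_1+W_1$ and $V_1+W_1+W_2$ respectively. Then $q*p_X\sim SN_p(F)$, the minimum risk equivariant (MRE) estimator is $\hat q_{\rm mre}(y;X)=q*p_X(y-X)$, and: (a) The estimator $q*p_X(y-\hat\mu(X))$ dominates the MRE estimator $q*p_X(y-X)$ if and only if $\hat\mu(X)$ dominates $X$ as a point estimator of $\mu$ under the loss $$f(\|\hat\mu-\mu\|^2)=K-\int_{\mathbb{R}_+}(2\pi t)^{-p/2}\,e^{-\frac{\|\hat\mu-\mu\|^2}{2t}}\,dJ(t),$$ $K$ being a constant. (b) The estimator $q*p_X(y-\hat\mu(X))$ dominates the MRE estimator $q*p_X(y-X)$ whenever $\hat\mu(X')$ dominates $X'$ under squared-error loss $\|\hat\mu-\mu\|^2$ for $X'-\mu\sim SN_p(F_Z)$, $F_Z$ being the cdf of $$Z=^d\frac{Z_1Z_2}{Z_1+Z_2},\quad\text{with }(Z_1,Z_2)\sim d\tau(z_1,z_2)\propto\frac{1}{z_2\,(z_1+z_2)^{p/2}}\,dG(z_1)\,dJ(z_2).$$ (c) Assuming $E(Z)$ and $E(Z^{-1})$ exist (are finite), $\hat q_{\rm mre}$ is inadmissible for $p\ge 3$ and dominated by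 $q*p_X(y-\hat\mu_{a,r(\cdot)}(X))$, where $\hat\mu_{a,r(\cdot)}(X)=\left(1-a\,\frac{r(X'X)}{X'X}\right)X$ (here $X'X=\|X\|^2$) is any Baranchik type estimator such that $r(\cdot)$ is an increasing function, $r(t)/t$ decreases in $t$, $0\le r(\cdot)\le1$, $r(\cdot)\ne0$, and $0<a\le\frac{2(p-2)}{E(Z^{-1})}$.
   Context: A density $p_X$ on $\mathbb{R}^p$ is a scale mixture of normals, written $p_X\sim SN_p(G)$, if $p_X(x)=\int_{\mathbb{R}_+}(2\pi v)^{-p/2}e^{-\|x\|^2/(2v)}\,dG(v)$ for a cdf $G$ on $\mathbb{R}_+$. For the model mixing distributions it is further assumed that $E(V^{-p/2})<\infty$ for $V\sim G$ and $E(W^{-p/2})<\infty$ for $W\sim H$. The convolution is $q*g(t)=\int_{\mathbb{R}^p}q(t-u)g(u)\,du$. The integrated $L_2$ loss of an estimate $\hat q(\cdot;x)$ is $\int_{\mathbb{R}^p}(q(y-\mu)-\hat q(y;x))^2\,dy$; risk is its expectation over $X$. One estimator dominates another if its risk is $\le$ for all $\mu$ with strict inequality for some $\mu$ (same definition for point estimators under a given loss); an estimator is inadmissible if some estimator dominates it. An equivariant estimator satisfies $\hat q(y;x)=\hat q(y-x;0)$ for all $x,y$; such estimators have constant risk, and the MRE estimator is the one with smallest risk. *)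

theory Defs
  imports "HOL-Probability.Probability"
begin

text \<open>
  A mixing cdf on the positive half-line is represented by the probability measure it generates,
  so that integrals against \<open>dG\<close> are integrals with respect to that measure.
  There is no mass at \<open>0\<close>, where the normal density is undefined.
\<close>

definition positive_distribution :: "real measure \<Rightarrow> bool" where
  "positive_distribution G \<longleftrightarrow> real_distribution G \<and> (AE v in G. 0 < v)"

definition sn_density :: "real measure \<Rightarrow> 'a::euclidean_space \<Rightarrow> real" where
  "sn_density G x =
     (\<integral>v. (2 * pi * v) powr (- (real DIM('a) / 2)) * exp (- (norm x)\<^sup>2 / (2 * v)) \<partial>G)"

definition scale_mixture_normal :: "('a::euclidean_space \<Rightarrow> real) \<Rightarrow> real measure \<Rightarrow> bool" where
  "scale_mixture_normal f G \<longleftrightarrow>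
     positive_distribution G \<and>
     f \<in> borel_measurable borel \<and> (\<forall>x. 0 \<le> f x) \<and> (\<integral>\<^sup>+x. ennreal (f x) \<partial>lborel) = 1 \<and>
     (\<forall>x. f x = sn_density G x)"

definition convol :: "('a::euclidean_space \<Rightarrow> real) \<Rightarrow> ('a \<Rightarrow> real) \<Rightarrow> 'a \<Rightarrow> real" where
  "convol q g t = (\<integral>u. q (t - u) * g u \<partial>lborel)"

definition location_law :: "('a::euclidean_space \<Rightarrow> real) \<Rightarrow> 'a \<Rightarrow> 'a measure" where
  "location_law pX \<mu> = density lborel (\<lambda>x. ennreal (pX (x - \<mu>)))"

definition risk_dominates :: "('m \<Rightarrow> 'r::linorder) \<Rightarrow> ('m \<Rightarrow> 'r) \<Rightarrow> bool" where
  "risk_dominates R R' \<longleftrightarrow> (\<forall>\<mu>. R \<mu> \<le> R' \<mu>) \<and> (\<exists>\<mu>. R \<mu> < R' \<mu>)"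

text \<open>
  Estimators of the density are written \<open>e y x\<close>, with \<open>y\<close> the argument of the estimated density
  and \<open>x\<close> the observation. They need not be densities themselves. Risks may be infinite.
\<close>

definition density_estimator :: "('a::euclidean_space \<Rightarrow> 'a \<Rightarrow> real) \<Rightarrow> bool" where
  "density_estimator e \<longleftrightarrow> (\<lambda>(y, x). e y x) \<in> borel_measurable (borel \<Otimes>\<^sub>M borel)"

definition L2_loss :: "('a::euclidean_space \<Rightarrow> real) \<Rightarrow> 'a \<Rightarrow> ('a \<Rightarrow> real) \<Rightarrow> ennreal" where
  "L2_loss q \<mu> g = (\<integral>\<^sup>+y. ennreal ((q (y - \<mu>) - g y)\<^sup>2) \<partial>lborel)"

definition density_risk ::
  "('a::euclidean_space \<Rightarrow> real) \<Rightarrow> ('a \<Rightarrow> real) \<Rightarrow> ('a \<Rightarrow> 'a \<Rightarrow> real) \<Rightarrow> 'a \<Rightarrow> ennreal" where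
  "density_risk q pX e \<mu> = (\<integral>\<^sup>+x. L2_loss q \<mu> (\<lambda>y. e y x) \<partial>location_law pX \<mu>)"

definition density_dominates ::
  "('a::euclidean_space \<Rightarrow> real) \<Rightarrow> ('a \<Rightarrow> real) \<Rightarrow>
   ('a \<Rightarrow> 'a \<Rightarrow> real) \<Rightarrow> ('a \<Rightarrow> 'a \<Rightarrow> real) \<Rightarrow> bool" where
  "density_dominates q pX e e' \<longleftrightarrow>
     density_estimator e \<and> density_estimator e' \<and>
     risk_dominates (density_risk q pX e) (density_risk q pX e')"

definition density_inadmissible ::
  "('a::euclidean_space \<Rightarrow> real) \<Rightarrow> ('a \<Rightarrow> real) \<Rightarrow> ('a \<Rightarrow> 'a \<Rightarrow> real) \<Rightarrow> bool" where
  "density_inadmissible q pX e \<longleftrightarrow> (\<exists>e'. density_dominates q pX e' e)"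

definition equivariant_estimator :: "('a::euclidean_space \<Rightarrow> 'a \<Rightarrow> real) \<Rightarrow> bool" where
  "equivariant_estimator e \<longleftrightarrow> density_estimator e \<and> (\<forall>x y. e y x = e (y - x) 0)"

text \<open>Being \<^emph>\<open>the\<close> best equivariant estimator includes uniqueness up to null sets in \<open>y\<close>.\<close>

definition is_MRE ::
  "('a::euclidean_space \<Rightarrow> real) \<Rightarrow> ('a \<Rightarrow> real) \<Rightarrow> ('a \<Rightarrow> 'a \<Rightarrow> real) \<Rightarrow> bool" where
  "is_MRE q pX e \<longleftrightarrow>
     equivariant_estimator e \<and>
     (\<forall>e'. equivariant_estimator e' \<longrightarrow>
        (\<forall>\<mu>. density_risk q pX e \<mu> \<le> density_risk q pX e' \<mu>) \<and>
        ((\<forall>\<mu>. density_risk q pX e' \<mu> = density_risk q pX e \<mu>) \<longrightarrow>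
           (\<forall>x. AE y in lborel. e' y x = e y x)))"

text \<open>
  The losses for point estimation may take negative values (the additive constant of a loss is
  arbitrary) and may have infinite expectation, so expectations are extended-real valued,
  as positive part minus negative part. All losses used are bounded below, so the
  indeterminate form does not occur.
\<close>

definition ext_expectation :: "'a measure \<Rightarrow> ('a \<Rightarrow> real) \<Rightarrow> ereal" where
  "ext_expectation M f =
     enn2ereal (\<integral>\<^sup>+x. ennreal (f x) \<partial>M) - enn2ereal (\<integral>\<^sup>+x. ennreal (- f x) \<partial>M)"

definition point_risk ::
  "('a::euclidean_space \<Rightarrow> real) \<Rightarrow> ('a \<Rightarrow> 'a \<Rightarrow> real) \<Rightarrow> ('a \<Rightarrow> 'a) \<Rightarrow> 'a \<Rightarrow> ereal" where
  "point_risk pX L m \<mu> = ext_expectation (location_law pX \<mu>) (\<lambda>x. L (m x) \<mu>)"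

definition point_dominates ::
  "('a::euclidean_space \<Rightarrow> real) \<Rightarrow> ('a \<Rightarrow> 'a \<Rightarrow> real) \<Rightarrow> ('a \<Rightarrow> 'a) \<Rightarrow> ('a \<Rightarrow> 'a) \<Rightarrow> bool" where
  "point_dominates pX L m m' \<longleftrightarrow>
     m \<in> borel_measurable borel \<and> m' \<in> borel_measurable borel \<and>
     risk_dominates (point_risk pX L m) (point_risk pX L m')"

definition tau_weight :: "nat \<Rightarrow> real \<times> real \<Rightarrow> real" where
  "tau_weight p = (\<lambda>(z1, z2). 1 / (z2 * (z1 + z2) powr (real p / 2)))"

text \<open>
  The weight is normalised by its total mass, which is positive, and finite when the
  distributions \<open>G\<close> and \<open>H\<close> underlying \<open>J\<close> have finite moments of order \<open>- p / 2\<close>.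
\<close>

definition tau :: "nat \<Rightarrow> real measure \<Rightarrow> real measure \<Rightarrow> (real \<times> real) measure" where
  "tau p G J =
     density (G \<Otimes>\<^sub>M J)
       (\<lambda>z. ennreal (tau_weight p z) / (\<integral>\<^sup>+z'. ennreal (tau_weight p z') \<partial>(G \<Otimes>\<^sub>M J)))"

definition Z_law :: "nat \<Rightarrow> real measure \<Rightarrow> real measure \<Rightarrow> real measure" where
  "Z_law p G J = distr (tau p G J) borel (\<lambda>(z1, z2). z1 * z2 / (z1 + z2))"

definition baranchik :: "real \<Rightarrow> (real \<Rightarrow> real) \<Rightarrow> 'a::euclidean_space \<Rightarrow> 'a" where
  "baranchik a r x = (1 - a * (r (x \<bullet> x) / (x \<bullet> x))) *\<^sub>R x"

end

theory Submission
  imports Defs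
begin

text \<open>
  The proof rests on completing the square: the product of two Gaussian kernels of variances \<open>v\<close> and \<open>w\<close>
  is a Gaussian density of variance \<open>v * w / (v + w)\<close> times a Gaussian kernel of variance \<open>v + w\<close> in
  the difference of the centres (\<open>gauss_mult\<close>). Integrated, it shows that inner products of translated
  scale mixtures are scale mixtures with convolved mixing laws (\<open>nn_integral_mix_mult\<close>). Hence \<open>q * pX\<close>
  has mixing law \<open>F\<close>, and the integrated \<open>L\<^sub>2\<close> loss of \<open>q * pX\<close> centred at \<open>m\<close> is a constant minus twice
  the mixture density with law \<open>J\<close> at \<open>m - \<mu>\<close> (\<open>L2_loss_plug_in\<close>). This is the dual point loss, and the
  equivalence of the two notions of dominance follows. For equivariant estimators the risk splits
  into variance plus squared bias at each point (\<open>equivariant_risk\<close>), which identifies the best one.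

  The dual loss is a concave function of the squared error, so it lies below its tangent at the
  observation. The slope of the tangent multiplied by \<open>pX\<close> is, by the same completion of the square,
  proportional to the mixture density with the law of \<open>Z\<close> (\<open>mix_mult_tangent_weight\<close>). An improvement
  of squared-error risk in that auxiliary model is therefore passed on to the density problem
  (\<open>overlap_mono_sq_risk\<close>). The squared-error risk of the observation is finite there, since
  \<open>u * exp (- u)\<close> is bounded.

  It remains to show that a Baranchik estimator does not increase the squared-error risk in the
  auxiliary model. Given \<open>Z = z\<close> the model is normal. Stein's identity is needed only as an inequality,
  and a dilation argument proves it from the monotonicity of \<open>r\<close> (\<open>stein_dilation\<close>). Averaging
  over \<open>z\<close> needs that \<open>z * E (r (X \<bullet> X) / (X \<bullet> X))\<close> increases in \<open>z\<close> (\<open>psi_scaled_mono\<close>). This in turn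
  reduces to the fact that the Gaussian mean of a decreasing radial function decreases when the
  centre moves away from the origin, proved by reflection
  (\<open>nn_integral_gauss_shift\<close>). Strict improvement is due to strict convexity of the exponential
  (\<open>overlap_sq_risk_less\<close>), since the squared-error risks themselves may coincide.
\<close>

section \<open>Isotropic Gaussian densities\<close>
definition gauss :: "real \<Rightarrow> 'a::euclidean_space \<Rightarrow> real" where
  "gauss v x = (2 * pi * v) powr (- (real DIM('a) / 2)) * exp (- (norm x)\<^sup>2 / (2 * v))"

lemma sn_density_gauss: "sn_density G x = (\<integral>v. gauss v x \<partial>G)"
  by (simp add: sn_density_def gauss_def)

lemma gauss_nonneg [simp]: "0 \<le> gauss v x"
  by (simp add: gauss_def)

lemma gauss_pos: "0 < v \<Longrightarrow> 0 < gauss v x"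
  by (simp add: gauss_def)

lemma gauss_commute: "gauss v (x - y) = gauss v (y - x)"
  by (simp add: gauss_def norm_minus_commute)

lemma measurable_gauss [measurable (raw)]:
  fixes g :: "'b \<Rightarrow> 'a::euclidean_space"
  assumes [measurable]: "f \<in> borel_measurable M" "g \<in> borel_measurable M"
  shows "(\<lambda>x. gauss (f x) (g x)) \<in> borel_measurable M"
  unfolding gauss_def by measurable

lemma gauss_le:
  assumes "0 < v"
  shows "gauss v (x::'a::euclidean_space)
           \<le> (2 * pi) powr (- (real DIM('a) / 2)) * v powr (- (real DIM('a) / 2))"
  using assms by (simp add: gauss_def powr_mult mult_left_le)

lemma nn_integral_lborel_affine:
  fixes f :: "'a::euclidean_space \<Rightarrow> ennreal"
  assumes [measurable]: "f \<in> borel_measurable borel" and c: "c \<noteq> 0"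
  shows "(\<integral>\<^sup>+x. f x \<partial>lborel) = ennreal (\<bar>c\<bar> ^ DIM('a)) * (\<integral>\<^sup>+x. f (t + c *\<^sub>R x) \<partial>lborel)"
  by (subst lborel_affine[OF c, of t])
     (simp add: nn_integral_density nn_integral_distr nn_integral_cmult)

lemma nn_integral_lborel_translate:
  fixes f :: "'a::euclidean_space \<Rightarrow> ennreal"
  assumes [measurable]: "f \<in> borel_measurable borel"
  shows "(\<integral>\<^sup>+x. f (x - a) \<partial>lborel) = (\<integral>\<^sup>+x. f x \<partial>lborel)"
  using nn_integral_lborel_affine[of "\<lambda>x. f (x - a)" 1 a] by simp

lemma AE_lborel_translate:
  fixes P :: "'a::euclidean_space \<Rightarrow> bool"
  assumes [measurable]: "Measurable.pred borel P" and "AE x in lborel. P x"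
  shows "AE x in lborel. P (x - a)"
proof -
  have "AE x in distr lborel borel ((+) (- a)). P x"
    using assms(2) by (simp only: lborel_distr_plus)
  then show ?thesis
    by (subst (asm) AE_distr_iff) auto
qed

lemma gauss_prod:
  fixes x :: "'a::euclidean_space"
  assumes "0 < v"
  shows "gauss v x = (\<Prod>b\<in>Basis. normal_density 0 (sqrt v) (x \<bullet> b))"
proof -
  have "(\<Prod>b\<in>Basis. normal_density 0 (sqrt v) (x \<bullet> b))
      = (\<Prod>b\<in>(Basis::'a set). 1 / sqrt (2 * pi * v)) * (\<Prod>b\<in>Basis. exp (- (x \<bullet> b)\<^sup>2 / (2 * v)))"
    using assms by (subst prod.distrib[symmetric]) (simp add: normal_density_def)
  also have "(\<Prod>b\<in>Basis. exp (- (x \<bullet> b)\<^sup>2 / (2 * v))) = exp (- (norm x)\<^sup>2 / (2 * v))"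
  proof -
    have "(norm x)\<^sup>2 = (\<Sum>b\<in>Basis. (x \<bullet> b)\<^sup>2)"
      unfolding power2_norm_eq_inner by (subst euclidean_inner) (simp add: power2_eq_square)
    then have "- (norm x)\<^sup>2 / (2 * v) = (\<Sum>b\<in>Basis. - (x \<bullet> b)\<^sup>2 / (2 * v))"
      by (simp only: sum_divide_distrib sum_negf[symmetric])
    then show ?thesis by (simp only: exp_sum[OF finite_Basis])
  qed
  also have "(\<Prod>b\<in>(Basis::'a set). 1 / sqrt (2 * pi * v)) = (2 * pi * v) powr (- (real DIM('a) / 2))"
  proof -
    have "1 / sqrt (2 * pi * v) = (2 * pi * v) powr (- (1 / 2))"
      using assms by (simp add: powr_minus_divide powr_half_sqrt)
    then have "(\<Prod>b\<in>(Basis::'a set). 1 / sqrt (2 * pi * v)) = ((2 * pi * v) powr (- (1 / 2))) ^ DIM('a)"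
      by simp
    also have "\<dots> = ((2 * pi * v) powr (- (1 / 2))) powr real DIM('a)"
      using assms by (subst powr_realpow) auto
    finally show ?thesis by (simp add: powr_powr)
  qed
  finally show ?thesis by (simp add: gauss_def)
qed

lemma nn_integral_gauss:
  fixes a :: "'a::euclidean_space"
  assumes "0 < v"
  shows "(\<integral>\<^sup>+x. ennreal (gauss v (x - a)) \<partial>lborel) = 1"
proof -
  have one: "(\<integral>\<^sup>+x. ennreal (normal_density 0 (sqrt v) x) \<partial>lborel) = 1"
    using assms by (simp add: nn_integral_eq_integral)
  have "(\<integral>\<^sup>+x. ennreal (gauss v (x - a)) \<partial>lborel) = (\<integral>\<^sup>+x. ennreal (gauss v (x::'a)) \<partial>lborel)"
    by (rule nn_integral_lborel_translate) measurable
  also have "\<dots> = (\<integral>\<^sup>+x. (\<Prod>b\<in>Basis. ennreal (normal_density 0 (sqrt v) (x \<bullet> b))) \<partial>(lborel::'a measure))"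
    using assms by (simp add: gauss_prod prod_ennreal)
  also have "\<dots> = (\<Prod>b\<in>(Basis::'a set). (\<integral>\<^sup>+x. ennreal (normal_density 0 (sqrt v) x) \<partial>lborel))"
    by (rule nn_integral_lborel_prod) auto
  finally show ?thesis by (simp add: one)
qed

text \<open>Completing the square. The product of two Gaussian kernels splits into a probability density in
  \<open>x\<close> and a factor free of \<open>x\<close>. The first factor has variance \<open>v * w / (v + w)\<close>, the harmonic
  combination that defines \<open>Z\<close>; the second has variance \<open>v + w\<close>, which is why mixing laws convolve.\<close>

lemma gauss_mult:
  fixes x :: "'a::euclidean_space"
  assumes v: "0 < v" and w: "0 < w"
  shows "gauss v (x - a) * gauss w (x - b)
       = gauss (v * w / (v + w)) (x - (w / (v + w)) *\<^sub>R a - (v / (v + w)) *\<^sub>R b) * gauss (v + w) (a - b)"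
proof -
  let ?k = "- (real DIM('a) / 2)"
  define u where "u = v + w"
  have u: "u > 0" "v + w = u" using v w by (auto simp: u_def)
  define c where "c = x - (w / u) *\<^sub>R a - (v / u) *\<^sub>R b"
  have sc: "u *\<^sub>R c = w *\<^sub>R (x - a) + v *\<^sub>R (x - b)"
  proof -
    have "u *\<^sub>R c = u *\<^sub>R x - w *\<^sub>R a - v *\<^sub>R b"
      using u(1) by (simp add: c_def scaleR_diff_right)
    then show ?thesis by (simp add: u_def algebra_simps)
  qed
  have n: "u\<^sup>2 * (norm c)\<^sup>2 = (norm (w *\<^sub>R (x - a) + v *\<^sub>R (x - b)))\<^sup>2"
    using u(1) by (simp flip: sc add: power_mult_distrib)
  have "(norm (x - a))\<^sup>2 / v + (norm (x - b))\<^sup>2 / w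
      = (norm c)\<^sup>2 / (v * w / u) + (norm (a - b))\<^sup>2 / u"
  proof -
    have ab: "a - b = (x - b) - (x - a)" by simp
    have "(norm (w *\<^sub>R P + v *\<^sub>R Q))\<^sup>2 + v * w * (norm (Q - P))\<^sup>2
        = (v + w) * (w * (norm P)\<^sup>2 + v * (norm Q)\<^sup>2)" for P Q :: 'a
      unfolding power2_norm_eq_inner
      by (simp add: inner_diff_left inner_diff_right inner_add_left inner_add_right
            inner_commute[of Q P]) (simp add: algebra_simps)
    from this[of "x - a" "x - b"]
    have "u\<^sup>2 * (norm c)\<^sup>2 + v * w * (norm (a - b))\<^sup>2
       = u * (w * (norm (x - a))\<^sup>2 + v * (norm (x - b))\<^sup>2)"
      by (simp only: n ab[symmetric] u(2))
    then show ?thesis using v w u(1)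
      by (simp add: divide_simps) (simp add: algebra_simps power2_eq_square)
  qed
  from arg_cong[OF this, of "\<lambda>t. - (t / 2)"] have e: "- (norm (x - a))\<^sup>2 / (2 * v) + - (norm (x - b))\<^sup>2 / (2 * w)
      = - (norm c)\<^sup>2 / (2 * (v * w / u)) + - (norm (a - b))\<^sup>2 / (2 * u)"
    by (simp add: add_divide_distrib mult.commute)
  have p: "(2 * pi * v) powr ?k * (2 * pi * w) powr ?k
      = (2 * pi * (v * w / u)) powr ?k * (2 * pi * u) powr ?k"
    using v w u(1) by (simp flip: powr_mult add: mult_ac)
  have "exp (- (norm (x - a))\<^sup>2 / (2 * v)) * exp (- (norm (x - b))\<^sup>2 / (2 * w))
      = exp (- (norm c)\<^sup>2 / (2 * (v * w / u))) * exp (- (norm (a - b))\<^sup>2 / (2 * u))"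
    by (simp only: exp_add[symmetric] e)
  from arg_cong2[OF p this, of "(*)"] show ?thesis
    unfolding gauss_def u(2) c_def[symmetric] by (simp only: mult_ac)
qed

lemma nn_integral_gauss_mult:
  fixes a b :: "'a::euclidean_space"
  assumes "0 < v" "0 < w"
  shows "(\<integral>\<^sup>+x. ennreal (gauss v (x - a)) * ennreal (gauss w (x - b)) \<partial>lborel)
       = ennreal (gauss (v + w) (a - b))"
  using assms nn_integral_gauss[of "v * w / (v + w)" "(w / (v + w)) *\<^sub>R a + (v / (v + w)) *\<^sub>R b"]
  by (simp add: ennreal_mult[symmetric] gauss_mult)
     (simp add: ennreal_mult nn_integral_multc diff_diff_eq)

section \<open>Scale mixtures and their convolutions\<close>
lemma nn_integral_swap:
  assumes "sigma_finite_measure M" "sigma_finite_measure N"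
    and "(\<lambda>(x, y). f x y) \<in> borel_measurable (M \<Otimes>\<^sub>M N)"
  shows "(\<integral>\<^sup>+x. \<integral>\<^sup>+y. f x y \<partial>N \<partial>M) = (\<integral>\<^sup>+y. \<integral>\<^sup>+x. f x y \<partial>M \<partial>N)"
proof -
  interpret pair_sigma_finite M N
    using assms by (simp add: pair_sigma_finite_def)
  show ?thesis using Fubini'[OF assms(3)] by simp
qed

text \<open>The scale mixture density with values in the extended nonnegative reals: it is \<open>\<infinity>\<close> where the
  Bochner integral defining \<^const>\<open>sn_density\<close> fails to converge and so silently returns \<open>0\<close>. Only the
  origin is at risk when the mixing law is positive.\<close>

definition mix :: "real measure \<Rightarrow> 'a::euclidean_space \<Rightarrow> ennreal" where
  "mix G x = (\<integral>\<^sup>+v. ennreal (gauss v x) \<partial>G)"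

lemma positive_distributionD:
  assumes "positive_distribution G"
  shows "prob_space G" "sigma_finite_measure G" "finite_measure G"
    "sets G = sets borel" "AE v in G. 0 < v"
proof -
  interpret real_distribution G using assms by (simp add: positive_distribution_def)
  show "prob_space G" "sigma_finite_measure G" "finite_measure G" "sets G = sets borel"
    by unfold_locales simp_all
  show "AE v in G. 0 < v" using assms by (simp add: positive_distribution_def)
qed

lemma measurable_mix:
  assumes G: "positive_distribution G"
  shows "mix G \<in> borel_measurable borel"
proof -
  note [measurable_cong] = positive_distributionD(4)[OF G]
  interpret sigma_finite_measure G by (rule positive_distributionD[OF G])
  show ?thesis unfolding mix_def by measurable
qed

lemma measurable_sn_density:
  assumes G: "positive_distribution G"
  shows "sn_density G \<in> borel_measurable borel"
proof -
  note [measurable_cong] = positive_distributionD(4)[OF G]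
  interpret sigma_finite_measure G by (rule positive_distributionD[OF G])
  show ?thesis unfolding sn_density_gauss[abs_def] by measurable
qed

lemma sn_density_nonneg: "0 \<le> sn_density G x"
  by (simp add: sn_density_gauss)

lemma mix_commute: "mix G (x - y) = mix G (y - x)"
  by (simp add: mix_def gauss_commute)

lemma nn_integral_mix:
  assumes G: "positive_distribution G"
  shows "(\<integral>\<^sup>+x. mix G (x - a) \<partial>lborel) = 1"
proof -
  note [measurable_cong] = positive_distributionD(4)[OF G]
  interpret prob_space G by (rule positive_distributionD[OF G])
  have "(\<integral>\<^sup>+x. mix G (x - a) \<partial>lborel) = (\<integral>\<^sup>+v. \<integral>\<^sup>+x. ennreal (gauss v (x - a)) \<partial>lborel \<partial>G)"
    unfolding mix_def
    by (rule nn_integral_swap) (unfold_locales, measurable)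
  also have "\<dots> = (\<integral>\<^sup>+v. 1 \<partial>G)"
    using positive_distributionD(5)[OF G] by (intro nn_integral_cong_AE) (auto simp: nn_integral_gauss)
  finally show ?thesis by (simp add: emeasure_space_1)
qed

lemma sn_density_eq_mix:
  assumes G: "positive_distribution G" and "mix G x \<noteq> \<infinity>"
  shows "ennreal (sn_density G x) = mix G x"
proof -
  note [measurable_cong] = positive_distributionD(4)[OF G]
  have "sn_density G x = enn2real (mix G x)"
    unfolding sn_density_gauss mix_def by (rule integral_eq_nn_integral) auto
  then show ?thesis using assms(2) by (simp add: less_top)
qed

text \<open>Tonelli gives the mixture total mass \<open>1\<close>, so it is finite almost everywhere. In this form
  the two densities can be exchanged for the law of \<open>Z\<close>, whose negative moments are not estimated here.\<close>

lemma AE_sn_density_eq_mix: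
  assumes G: "positive_distribution G"
  shows "AE x in lborel. ennreal (sn_density G x) = mix G x"
proof -
  have "AE x in lborel. mix G (x::'a::euclidean_space) \<noteq> \<infinity>"
    using nn_integral_mix[OF G, of "0::'a"]
    by (intro nn_integral_noteq_infinite) (simp_all add: measurable_mix[OF G])
  then show ?thesis by eventually_elim (rule sn_density_eq_mix[OF G])
qed

definition mixing_law :: "nat \<Rightarrow> real measure \<Rightarrow> bool" where
  "mixing_law p G \<longleftrightarrow> positive_distribution G \<and> integrable G (\<lambda>v. v powr (- (real p / 2)))"

definition sn_bound :: "nat \<Rightarrow> real measure \<Rightarrow> real" where
  "sn_bound p G = (2 * pi) powr (- (real p / 2)) * (\<integral>v. v powr (- (real p / 2)) \<partial>G)"

lemma mixing_law_positive: "mixing_law p G \<Longrightarrow> positive_distribution G"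
  by (simp add: mixing_law_def)

lemma mix_le:
  assumes G: "mixing_law DIM('a) G"
  shows "mix G (x::'a::euclidean_space) \<le> ennreal (sn_bound DIM('a) G)"
proof -
  note [measurable_cong] = positive_distributionD(4)[OF mixing_law_positive[OF G]]
  have "mix G x \<le> (\<integral>\<^sup>+v. ennreal ((2 * pi) powr (- (real DIM('a) / 2)) * v powr (- (real DIM('a) / 2))) \<partial>G)"
    unfolding mix_def using positive_distributionD(5)[OF mixing_law_positive[OF G]]
    by (intro nn_integral_mono_AE) (auto elim!: eventually_mono intro!: ennreal_leI gauss_le)
  also have "\<dots> = ennreal (sn_bound DIM('a) G)"
    using G by (subst nn_integral_eq_integral) (auto simp: mixing_law_def sn_bound_def)
  finally show ?thesis .
qed

lemma mix_mixing_law: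
  assumes G: "mixing_law DIM('a) G"
  shows "mix G (x::'a::euclidean_space) = ennreal (sn_density G x)"
proof -
  have "mix G x \<noteq> \<infinity>" using le_less_trans[OF mix_le[OF G, of x] ennreal_less_top] by auto
  then show ?thesis using sn_density_eq_mix[OF mixing_law_positive[OF G], of x] by simp
qed

lemma sn_bound_nonneg: "0 \<le> sn_bound p G"
  by (simp add: sn_bound_def)

lemma sn_density_le:
  assumes G: "mixing_law DIM('a) G"
  shows "sn_density G (x::'a::euclidean_space) \<le> sn_bound DIM('a) G"
  using mix_le[OF G, of x] by (simp add: mix_mixing_law[OF G] ennreal_le_iff sn_bound_nonneg)

lemma convolution_mixing_law:
  assumes G: "positive_distribution G" and H: "positive_distribution H"
  shows "positive_distribution (G \<star> H)"
    and "mixing_law p G \<Longrightarrow> mixing_law p (G \<star> H)"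
proof -
  note [measurable_cong] = positive_distributionD(4)[OF G] positive_distributionD(4)[OF H]
  interpret G: prob_space G by (rule positive_distributionD[OF G])
  interpret H: prob_space H by (rule positive_distributionD[OF H])
  interpret GH: pair_prob_space G H ..
  have pos: "AE v in G. AE w in H. 0 < v + w"
    using positive_distributionD(5)[OF G]
  proof eventually_elim
    case (elim v)
    show ?case using positive_distributionD(5)[OF H] by eventually_elim (use elim in simp)
  qed
  have "prob_space (G \<star> H)"
    unfolding convolution_def by (rule GH.prob_space_distr) measurable
  moreover have "AE v in G \<star> H. 0 < v"
  proof -
    have "AE z in G \<Otimes>\<^sub>M H. case z of (v, w) \<Rightarrow> 0 < v + w"
      using pos by (intro GH.AE_pair_measure) auto
    then show ?thesis unfolding convolution_def by (subst AE_distr_iff) (auto simp: case_prod_beta)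
  qed
  ultimately show posGH: "positive_distribution (G \<star> H)"
    by (simp add: positive_distribution_def real_distribution_def real_distribution_axioms_def)
  assume m: "mixing_law p G"
  let ?f = "\<lambda>v. v powr (- (real p / 2))"
  have "(\<integral>\<^sup>+v. ennreal (?f v) \<partial>(G \<star> H)) = (\<integral>\<^sup>+v. \<integral>\<^sup>+w. ennreal (?f (v + w)) \<partial>H \<partial>G)"
    using positive_distributionD(3,4)[OF G] positive_distributionD(3,4)[OF H]
    by (intro nn_integral_convolution) auto
  also have "\<dots> \<le> (\<integral>\<^sup>+v. \<integral>\<^sup>+w. ennreal (?f v) \<partial>H \<partial>G)"
    using positive_distributionD(5)[OF G]
  proof (intro nn_integral_mono_AE, eventually_elim)
    case (elim v)
    show ?case
      using positive_distributionD(5)[OF H] elim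
      by (intro nn_integral_mono_AE) (auto elim!: eventually_mono intro!: ennreal_leI powr_mono2')
  qed
  also have "\<dots> = (\<integral>\<^sup>+v. ennreal (?f v) \<partial>G)" by (simp add: H.emeasure_space_1)
  also have "\<dots> < \<infinity>"
    using m by (subst nn_integral_eq_integral) (auto simp: mixing_law_def)
  finally show "mixing_law p (G \<star> H)"
    using posGH by (auto simp: mixing_law_def intro!: integrableI_nonneg)
qed

text \<open>The inner product of two translated mixtures is again a mixture, evaluated at the difference of
  the locations. Everything about the loss follows from this formula.\<close>

lemma nn_integral_mix_mult:
  fixes a b :: "'a::euclidean_space"
  assumes G: "positive_distribution G" and H: "positive_distribution H"
  shows "(\<integral>\<^sup>+y. mix G (y - a) * mix H (y - b) \<partial>lborel) = mix (G \<star> H) (a - b)"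
proof -
  note [measurable_cong] = positive_distributionD(4)[OF G] positive_distributionD(4)[OF H]
  interpret G: prob_space G by (rule positive_distributionD[OF G])
  interpret H: prob_space H by (rule positive_distributionD[OF H])
  let ?f = "\<lambda>v w y. ennreal (gauss v (y - a)) * ennreal (gauss w (y - b))"
  have "(\<integral>\<^sup>+y. mix G (y - a) * mix H (y - b) \<partial>lborel)
      = (\<integral>\<^sup>+y. \<integral>\<^sup>+v. \<integral>\<^sup>+w. ?f v w y \<partial>H \<partial>G \<partial>lborel)"
    unfolding mix_def by (simp add: nn_integral_cmult nn_integral_multc)
  also have "\<dots> = (\<integral>\<^sup>+v. \<integral>\<^sup>+y. \<integral>\<^sup>+w. ?f v w y \<partial>H \<partial>lborel \<partial>G)"
    by (rule nn_integral_swap) (unfold_locales, measurable)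
  also have "\<dots> = (\<integral>\<^sup>+v. \<integral>\<^sup>+w. \<integral>\<^sup>+y. ?f v w y \<partial>lborel \<partial>H \<partial>G)"
    by (intro nn_integral_cong nn_integral_swap) (unfold_locales, measurable)
  also have "\<dots> = (\<integral>\<^sup>+v. \<integral>\<^sup>+w. ennreal (gauss (v + w) (a - b)) \<partial>H \<partial>G)"
    using positive_distributionD(5)[OF G]
  proof (intro nn_integral_cong_AE, eventually_elim)
    case (elim v)
    show ?case using positive_distributionD(5)[OF H] elim
      by (intro nn_integral_cong_AE) (auto elim!: eventually_mono simp: nn_integral_gauss_mult)
  qed
  also have "\<dots> = mix (G \<star> H) (a - b)"
    unfolding mix_def
    using positive_distributionD(3,4)[OF G] positive_distributionD(3,4)[OF H]
    by (intro nn_integral_convolution[symmetric]) auto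
  finally show ?thesis .
qed

section \<open>The plug-in loss and the overlap of densities\<close>

locale scale_mixture_model =
  fixes q pX :: "'a::euclidean_space \<Rightarrow> real" and G H :: "real measure"
  assumes q_smn: "scale_mixture_normal q H" and pX_smn: "scale_mixture_normal pX G"
    and G_moment: "integrable G (\<lambda>v. v powr (- (real DIM('a) / 2)))"
    and H_moment: "integrable H (\<lambda>v. v powr (- (real DIM('a) / 2)))"
begin

definition F :: "real measure" where "F = (G \<star> H)"
definition J :: "real measure" where "J = (F \<star> H)"
definition g :: "'a \<Rightarrow> real" where "g = convol q pX"
abbreviation P :: "'a \<Rightarrow> 'a measure" where "P \<equiv> location_law pX"

lemma G: "mixing_law DIM('a) G" and H: "mixing_law DIM('a) H"
  using q_smn pX_smn G_moment H_moment by (auto simp: mixing_law_def scale_mixture_normal_def)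

lemma F: "mixing_law DIM('a) F"
  unfolding F_def
  using convolution_mixing_law(2)[OF mixing_law_positive[OF G] mixing_law_positive[OF H] G] .

lemma J: "mixing_law DIM('a) J"
  unfolding J_def
  using convolution_mixing_law(2)[OF mixing_law_positive[OF F] mixing_law_positive[OF H] F] .

lemma q: "q x = sn_density H x" and pX: "pX x = sn_density G x"
  using q_smn pX_smn by (auto simp: scale_mixture_normal_def)

lemma ennreal_q: "ennreal (q x) = mix H x" and ennreal_pX: "ennreal (pX x) = mix G x"
  by (simp_all add: q pX mix_mixing_law G H)

lemma measurable_q [measurable]: "q \<in> borel_measurable borel"
  and measurable_pX [measurable]: "pX \<in> borel_measurable borel"
  using q_smn pX_smn by (auto simp: scale_mixture_normal_def)

lemma q_nonneg [simp]: "0 \<le> q x" and pX_nonneg [simp]: "0 \<le> pX x"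
  using q_smn pX_smn by (auto simp: scale_mixture_normal_def)

lemma g_eq: "g = sn_density F"
proof
  fix t :: 'a
  have "ennreal (sn_density F t) = mix F (- t)"
    using mix_commute[of F 0 t] by (simp add: mix_mixing_law[OF F, symmetric])
  also have "\<dots> = (\<integral>\<^sup>+u. mix G (u - 0) * mix H (u - t) \<partial>lborel)"
    using nn_integral_mix_mult[of G H 0 t] G H by (simp add: F_def mixing_law_positive)
  also have "\<dots> = (\<integral>\<^sup>+u. ennreal (q (t - u) * pX u) \<partial>lborel)"
    by (simp add: ennreal_mult ennreal_q ennreal_pX mix_commute[of H t] mult.commute)
  finally have "enn2real (\<integral>\<^sup>+u. ennreal (q (t - u) * pX u) \<partial>lborel) = sn_density F t"
    by (metis enn2real_ennreal sn_density_nonneg)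
  then show "g t = sn_density F t"
    unfolding g_def convol_def by (subst integral_eq_nn_integral) auto
qed

lemma ennreal_g: "ennreal (g x) = mix F x"
  by (simp add: g_eq mix_mixing_law F)

lemma measurable_g [measurable]: "g \<in> borel_measurable borel"
  unfolding g_eq by (rule measurable_sn_density[OF mixing_law_positive[OF F]])

lemma g_nonneg [simp]: "0 \<le> g x"
  by (simp add: g_eq sn_density_nonneg)

lemma g_smn: "scale_mixture_normal g F"
  unfolding scale_mixture_normal_def
  using nn_integral_mix[OF mixing_law_positive[OF F], of "0::'a"]
  by (auto simp: mixing_law_positive[OF F] ennreal_g) (simp add: g_eq)

lemma measurable_sJ [measurable]: "sn_density J \<in> borel_measurable borel"
  by (rule measurable_sn_density[OF mixing_law_positive[OF J]])

lemma prob_space_P: "prob_space (P \<mu>)"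
proof
  have "emeasure (P \<mu>) (space (P \<mu>)) = (\<integral>\<^sup>+x. mix G (x - \<mu>) \<partial>lborel)"
    unfolding location_law_def by (simp add: emeasure_density flip: ennreal_pX)
  then show "emeasure (P \<mu>) (space (P \<mu>)) = 1"
    using nn_integral_mix[OF mixing_law_positive[OF G], of \<mu>] by simp
qed

lemma sets_P [simp, measurable_cong]: "sets (P \<mu>) = sets borel"
  by (simp add: location_law_def)

lemma space_P [simp]: "space (P \<mu>) = UNIV"
  by (simp add: location_law_def)

lemma nn_integral_P:
  assumes [measurable]: "f \<in> borel_measurable borel"
  shows "(\<integral>\<^sup>+x. f x \<partial>P \<mu>) = (\<integral>\<^sup>+x. mix G (x - \<mu>) * f x \<partial>lborel)"
  unfolding location_law_def unfolding ennreal_pX[symmetric] by (subst nn_integral_density) auto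

text \<open>The part of the integrated \<open>L\<^sub>2\<close> loss that depends neither on \<open>\<mu>\<close> nor on the plugged-in
  location.\<close>

definition energy :: ennreal where
  "energy = (\<integral>\<^sup>+y. ennreal ((q y)\<^sup>2) \<partial>lborel) + (\<integral>\<^sup>+y. ennreal ((g y)\<^sup>2) \<partial>lborel)"

lemma nn_integral_sn_square_finite:
  assumes K: "mixing_law DIM('a) K"
  shows "(\<integral>\<^sup>+y. ennreal ((sn_density K (y::'a))\<^sup>2) \<partial>lborel) < \<infinity>"
proof -
  have "(\<integral>\<^sup>+y. ennreal ((sn_density K (y::'a))\<^sup>2) \<partial>lborel) = (\<integral>\<^sup>+y. mix K (y - 0) * mix K (y - (0::'a)) \<partial>lborel)"
    by (simp add: mix_mixing_law[OF K] power2_eq_square ennreal_mult sn_density_nonneg)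
  also have "\<dots> = mix (K \<star> K) (0::'a)"
    using nn_integral_mix_mult[of K K "0::'a" 0] K by (simp add: mixing_law_positive)
  also have "\<dots> = ennreal (sn_density (K \<star> K) (0::'a))"
    using K by (intro mix_mixing_law convolution_mixing_law) (auto simp: mixing_law_positive)
  finally show ?thesis by simp
qed

lemma energy_finite: "energy < \<infinity>"
  unfolding energy_def
  using nn_integral_sn_square_finite[OF H] nn_integral_sn_square_finite[OF F]
  by (simp add: q g_eq)

text \<open>Expanding the square, the two norms are translation invariant and only the inner product depends
  on \<open>m - \<mu>\<close>. The identity is written additively because the values are extended nonnegative reals.\<close>

lemma L2_loss_plug_in:
  "L2_loss q \<mu> (\<lambda>y. g (y - m)) + 2 * ennreal (sn_density J (m - \<mu>)) = energy"
proof -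
  have cross: "(\<integral>\<^sup>+y. ennreal (q (y - \<mu>) * g (y - m)) \<partial>lborel) = ennreal (sn_density J (m - \<mu>))"
    using nn_integral_mix_mult[of F H m \<mu>] F H
    by (simp add: ennreal_mult ennreal_q ennreal_g mixing_law_positive mult.commute mix_mixing_law[OF J] flip: J_def)
  have "L2_loss q \<mu> (\<lambda>y. g (y - m)) + 2 * ennreal (sn_density J (m - \<mu>))
     = (\<integral>\<^sup>+y. ennreal ((q (y - \<mu>) - g (y - m))\<^sup>2) + 2 * ennreal (q (y - \<mu>) * g (y - m)) \<partial>lborel)"
    unfolding L2_loss_def by (simp add: nn_integral_add nn_integral_cmult cross)
  also have "\<dots> = (\<integral>\<^sup>+y. ennreal ((q (y - \<mu>))\<^sup>2) + ennreal ((g (y - m))\<^sup>2) \<partial>lborel)"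
  proof (intro nn_integral_cong)
    fix y
    have "ennreal ((q (y - \<mu>) - g (y - m))\<^sup>2) + 2 * ennreal (q (y - \<mu>) * g (y - m))
        = ennreal ((q (y - \<mu>) - g (y - m))\<^sup>2 + 2 * (q (y - \<mu>) * g (y - m)))"
      by (subst ennreal_plus) (auto simp: ennreal_mult)
    also have "(q (y - \<mu>) - g (y - m))\<^sup>2 + 2 * (q (y - \<mu>) * g (y - m)) = (q (y - \<mu>))\<^sup>2 + (g (y - m))\<^sup>2"
      by (simp add: power2_eq_square algebra_simps)
    finally show "ennreal ((q (y - \<mu>) - g (y - m))\<^sup>2) + 2 * ennreal (q (y - \<mu>) * g (y - m))
       = ennreal ((q (y - \<mu>))\<^sup>2) + ennreal ((g (y - m))\<^sup>2)" by simp
  qed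
  also have "\<dots> = energy"
    unfolding energy_def
    using nn_integral_lborel_translate[of "\<lambda>y. ennreal ((q y)\<^sup>2)" \<mu>]
      nn_integral_lborel_translate[of "\<lambda>y. ennreal ((g y)\<^sup>2)" m]
    by (simp add: nn_integral_add)
  finally show ?thesis .
qed

text \<open>The expected inner product of true and estimated density. Density risk and point risk under the
  dual loss are both decreasing affine functions of it, so dominance in either sense is a comparison
  of overlaps.\<close>

definition overlap :: "('a \<Rightarrow> 'a) \<Rightarrow> 'a \<Rightarrow> real" where
  "overlap m \<mu> = (\<integral>x. sn_density J (m x - \<mu>) \<partial>P \<mu>)"

lemma overlap:
  assumes [measurable]: "m \<in> borel_measurable borel"
  shows "integrable (P \<mu>) (\<lambda>x. sn_density J (m x - \<mu>))"
    and "(\<integral>\<^sup>+x. ennreal (sn_density J (m x - \<mu>)) \<partial>P \<mu>) = ennreal (overlap m \<mu>)"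
    and "0 \<le> overlap m \<mu>"
proof -
  interpret prob_space "P \<mu>" by (rule prob_space_P)
  show *: "integrable (P \<mu>) (\<lambda>x. sn_density J (m x - \<mu>))"
    by (rule integrable_const_bound[where B = "sn_bound DIM('a) J"])
       (auto simp: sn_density_nonneg sn_density_le[OF J])
  show "(\<integral>\<^sup>+x. ennreal (sn_density J (m x - \<mu>)) \<partial>P \<mu>) = ennreal (overlap m \<mu>)"
    unfolding overlap_def using * by (rule nn_integral_eq_integral) (simp add: sn_density_nonneg)
  show "0 \<le> overlap m \<mu>" by (simp add: overlap_def sn_density_nonneg)
qed

lemma density_risk_plug_in:
  assumes [measurable]: "m \<in> borel_measurable borel"
  shows "density_risk q pX (\<lambda>y x. g (y - m x)) \<mu> + ennreal (2 * overlap m \<mu>) = energy"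
proof -
  interpret prob_space "P \<mu>" by (rule prob_space_P)
  have [measurable]: "(\<lambda>x. L2_loss q \<mu> (\<lambda>y. g (y - m x))) \<in> borel_measurable borel"
    unfolding L2_loss_def by measurable
  have "density_risk q pX (\<lambda>y x. g (y - m x)) \<mu> + ennreal (2 * overlap m \<mu>)
      = (\<integral>\<^sup>+x. L2_loss q \<mu> (\<lambda>y. g (y - m x)) + 2 * ennreal (sn_density J (m x - \<mu>)) \<partial>P \<mu>)"
    unfolding density_risk_def
    by (simp add: nn_integral_add nn_integral_cmult overlap ennreal_mult)
  also have "\<dots> = energy"
    by (simp add: L2_loss_plug_in emeasure_space_1[simplified])
  finally show ?thesis .
qed

lemma density_estimator_plug_in:
  assumes [measurable]: "m \<in> borel_measurable borel"
  shows "density_estimator (\<lambda>y x. g (y - m x))"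
  unfolding density_estimator_def by measurable

lemma density_risk_le_iff:
  assumes m: "m \<in> borel_measurable borel" "m' \<in> borel_measurable borel"
  shows "density_risk q pX (\<lambda>y x. g (y - m x)) \<mu> \<le> density_risk q pX (\<lambda>y x. g (y - m' x)) \<mu>
           \<longleftrightarrow> overlap m' \<mu> \<le> overlap m \<mu>"
proof -
  let ?R = "\<lambda>m. density_risk q pX (\<lambda>y x. g (y - m x)) \<mu>"
  have "?R m \<le> energy" "?R m' \<le> energy"
    using density_risk_plug_in[OF m(1), of \<mu>] density_risk_plug_in[OF m(2), of \<mu>]
    by (metis le_iff_add)+
  then have "?R m = ennreal (enn2real (?R m))" "?R m' = ennreal (enn2real (?R m'))"
    using energy_finite by (auto dest: le_less_trans)
  then obtain r r' where r: "?R m = ennreal r" "?R m' = ennreal r'" "r \<ge> 0" "r' \<ge> 0"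
    by (metis enn2real_nonneg)
  have "ennreal (r + 2 * overlap m \<mu>) = ennreal (r' + 2 * overlap m' \<mu>)"
    using density_risk_plug_in[OF m(1), of \<mu>] density_risk_plug_in[OF m(2), of \<mu>] r overlap(3)[OF m(1), of \<mu>]
      overlap(3)[OF m(2), of \<mu>] by (simp add: ennreal_plus)
  then have "r + 2 * overlap m \<mu> = r' + 2 * overlap m' \<mu>"
    using r overlap(3)[OF m(1), of \<mu>] overlap(3)[OF m(2), of \<mu>] by (subst (asm) ennreal_inj) auto
  then show ?thesis using r by (auto simp: ennreal_le_iff)
qed

lemma density_dominates_iff_overlap:
  assumes m: "m \<in> borel_measurable borel" "m' \<in> borel_measurable borel"
  shows "density_dominates q pX (\<lambda>y x. g (y - m x)) (\<lambda>y x. g (y - m' x)) \<longleftrightarrow>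
     (\<forall>\<mu>. overlap m' \<mu> \<le> overlap m \<mu>) \<and> (\<exists>\<mu>. overlap m' \<mu> < overlap m \<mu>)"
  unfolding density_dominates_def risk_dominates_def
  using m by (simp add: density_estimator_plug_in density_risk_le_iff not_le[symmetric])

lemma ext_expectation_integrable:
  assumes "integrable M f"
  shows "ext_expectation M f = ereal (\<integral>x. f x \<partial>M)"
proof -
  have fin: "(\<integral>\<^sup>+x. ennreal (f x) \<partial>M) < \<infinity>" "(\<integral>\<^sup>+x. ennreal (- f x) \<partial>M) < \<infinity>"
    using assms by (auto simp: real_integrable_def less_top)
  have *: "enn2ereal a = ereal (enn2real a)" if "a < \<infinity>" for a
    using that by (cases a) (auto simp: enn2ereal_ennreal)
  show ?thesis
    unfolding ext_expectation_def real_lebesgue_integral_def[OF assms] by (simp only: *[OF fin(1)] *[OF fin(2)] ereal_minus(1))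
qed

lemma point_risk_overlap:
  assumes m: "m \<in> borel_measurable borel"
  shows "point_risk pX (\<lambda>d \<mu>. K - sn_density J (d - \<mu>)) m \<mu> = ereal (K - overlap m \<mu>)"
proof -
  interpret prob_space "P \<mu>" by (rule prob_space_P)
  have "integrable (P \<mu>) (\<lambda>x. K - sn_density J (m x - \<mu>))"
    using overlap(1)[OF m, of \<mu>] by simp
  then show ?thesis
    unfolding point_risk_def using overlap(1)[OF m, of \<mu>] prob_space
    by (simp add: ext_expectation_integrable overlap_def)
qed

theorem dominance_iff_point_dominance:
  assumes m: "m \<in> borel_measurable borel"
  shows "density_dominates q pX (\<lambda>y x. g (y - m x)) (\<lambda>y x. g (y - x)) \<longleftrightarrow>
     point_dominates pX (\<lambda>d \<mu>. K - sn_density J (d - \<mu>)) m (\<lambda>x. x)"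
  using m by (simp add: density_dominates_iff_overlap point_dominates_def risk_dominates_def point_risk_overlap)

end

section \<open>The best equivariant estimator\<close>
context scale_mixture_model
begin

lemma measurable_mix_laws [measurable]:
  "(mix G :: 'a \<Rightarrow> ennreal) \<in> borel_measurable borel"
  "(mix H :: 'a \<Rightarrow> ennreal) \<in> borel_measurable borel"
  "(mix J :: 'a \<Rightarrow> ennreal) \<in> borel_measurable borel"
  using measurable_mix mixing_law_positive[OF G] mixing_law_positive[OF H]
    mixing_law_positive[OF J] by blast+

text \<open>The variance of \<open>q (t + U)\<close> for \<open>U\<close> with density \<open>pX\<close>. The mean of \<open>q (t + U)\<close> is \<open>g t\<close>, because \<open>pX\<close> is symmetric.\<close>

definition residual :: "'a \<Rightarrow> real" where
  "residual t = (\<integral>u. (q (t + u) - g t)\<^sup>2 \<partial>P 0)"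

lemma q_le: "q x \<le> sn_bound DIM('a) H"
  by (simp add: q sn_density_le[OF H])

lemma expectation_q:
  "integrable (P 0) (\<lambda>u. q (t + u))" "(\<integral>u. q (t + u) \<partial>P 0) = g t"
proof -
  interpret prob_space "P 0" by (rule prob_space_P)
  show *: "integrable (P 0) (\<lambda>u. q (t + u))"
    by (rule integrable_const_bound[where B = "sn_bound DIM('a) H"]) (auto simp: q_le)
  have "ennreal (\<integral>u. q (t + u) \<partial>P 0) = (\<integral>\<^sup>+u. ennreal (q (t + u)) \<partial>P 0)"
    using * by (simp add: nn_integral_eq_integral)
  also have "\<dots> = (\<integral>\<^sup>+u. mix G (u - 0) * mix H (u - (- t)) \<partial>lborel)"
    by (subst nn_integral_P) (simp_all add: ennreal_q add.commute)
  also have "\<dots> = mix F t"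
    using nn_integral_mix_mult[of G H 0 "- t"] G H by (simp add: F_def mixing_law_positive)
  finally show "(\<integral>u. q (t + u) \<partial>P 0) = g t"
    by (simp add: ennreal_g[symmetric] ennreal_inj)
qed

lemma bias_variance:
  "(\<integral>\<^sup>+u. ennreal ((q (t + u) - c)\<^sup>2) \<partial>P 0) = ennreal (residual t) + ennreal ((g t - c)\<^sup>2)"
proof -
  interpret prob_space "P 0" by (rule prob_space_P)
  note [simp] = expectation_q
  have sq: "integrable (P 0) (\<lambda>u. (q (t + u))\<^sup>2)"
    by (rule integrable_const_bound[where B = "(sn_bound DIM('a) H)\<^sup>2"])
       (auto simp: q_le intro!: power_mono)
  have expand: "(q (t + u) - d)\<^sup>2 = (q (t + u))\<^sup>2 - 2 * d * q (t + u) + d\<^sup>2" for u d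
    by (simp add: power2_eq_square algebra_simps)
  have val: "(\<integral>u. (q (t + u) - d)\<^sup>2 \<partial>P 0) = (\<integral>u. (q (t + u))\<^sup>2 \<partial>P 0) - 2 * d * g t + d\<^sup>2" for d
    unfolding expand using sq prob_space by simp
  have "(\<integral>\<^sup>+u. ennreal ((q (t + u) - c)\<^sup>2) \<partial>P 0) = ennreal (\<integral>u. (q (t + u) - c)\<^sup>2 \<partial>P 0)"
  proof (rule nn_integral_eq_integral)
    show "integrable (P 0) (\<lambda>u. (q (t + u) - c)\<^sup>2)"
      unfolding expand using sq by simp
  qed simp
  also have "(\<integral>u. (q (t + u) - c)\<^sup>2 \<partial>P 0) = residual t + (g t - c)\<^sup>2"
    unfolding residual_def val by (simp add: power2_eq_square algebra_simps)
  finally show ?thesis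
    by (simp add: ennreal_plus residual_def)
qed

text \<open>After the translation \<open>y = t + x\<close> and Tonelli, the risk of an equivariant estimator is an
  integral over \<open>t\<close> of a mean squared deviation about the constant \<open>e t 0\<close>. Bias and variance
  separate pointwise in \<open>t\<close>, which exhibits \<open>g\<close> as the minimiser, unique up to null sets.\<close>

lemma equivariant_risk:
  assumes e: "equivariant_estimator e"
  shows "density_risk q pX e \<mu>
       = (\<integral>\<^sup>+t. ennreal (residual t) \<partial>lborel) + (\<integral>\<^sup>+t. ennreal ((g t - e t 0)\<^sup>2) \<partial>lborel)"
proof -
  interpret P0: prob_space "P 0" by (rule prob_space_P)
  have [measurable]: "(\<lambda>(y, x). e y x) \<in> borel_measurable (borel \<Otimes>\<^sub>M borel)"
    using e by (simp add: equivariant_estimator_def density_estimator_def)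
  define e0 where "e0 t = e t 0" for t
  have [measurable]: "e0 \<in> borel_measurable borel"
    unfolding e0_def by measurable
  have e_eq: "e y x = e0 (y - x)" for x y
    using e by (auto simp: equivariant_estimator_def e0_def)
  have [measurable]: "residual \<in> borel_measurable borel"
    unfolding residual_def by measurable
  have "density_risk q pX e \<mu> = (\<integral>\<^sup>+x. (\<integral>\<^sup>+t. ennreal ((q (t + (x - \<mu>)) - e0 t)\<^sup>2) \<partial>lborel) \<partial>P \<mu>)"
    unfolding density_risk_def L2_loss_def e_eq
  proof (rule nn_integral_cong)
    fix x
    have "(\<integral>\<^sup>+y. (\<lambda>t. ennreal ((q (t + (x - \<mu>)) - e0 t)\<^sup>2)) (y - x) \<partial>lborel)
        = (\<integral>\<^sup>+t. ennreal ((q (t + (x - \<mu>)) - e0 t)\<^sup>2) \<partial>lborel)"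
      by (rule nn_integral_lborel_translate) measurable
    then show "(\<integral>\<^sup>+y. ennreal ((q (y - \<mu>) - e0 (y - x))\<^sup>2) \<partial>lborel)
        = (\<integral>\<^sup>+t. ennreal ((q (t + (x - \<mu>)) - e0 t)\<^sup>2) \<partial>lborel)"
      by (simp add: algebra_simps)
  qed
  also have "\<dots> = (\<integral>\<^sup>+u. (\<integral>\<^sup>+t. ennreal ((q (t + u) - e0 t)\<^sup>2) \<partial>lborel) \<partial>P 0)"
    using nn_integral_lborel_translate[of "\<lambda>u. mix G u * (\<integral>\<^sup>+t. ennreal ((q (t + u) - e0 t)\<^sup>2) \<partial>lborel)" \<mu>]
    by (simp add: nn_integral_P)
  also have "\<dots> = (\<integral>\<^sup>+t. (\<integral>\<^sup>+u. ennreal ((q (t + u) - e0 t)\<^sup>2) \<partial>P 0) \<partial>lborel)"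
    by (rule nn_integral_swap) (unfold_locales, measurable)
  also have "\<dots> = (\<integral>\<^sup>+t. ennreal (residual t) \<partial>lborel) + (\<integral>\<^sup>+t. ennreal ((g t - e0 t)\<^sup>2) \<partial>lborel)"
    by (simp add: bias_variance nn_integral_add)
  finally show ?thesis by (simp add: e0_def)
qed

theorem g_is_MRE: "is_MRE q pX (\<lambda>y x. g (y - x))"
proof -
  have eq: "equivariant_estimator (\<lambda>y x. g (y - x))"
    using density_estimator_plug_in[of "\<lambda>x. x"] by (simp add: equivariant_estimator_def)
  have risk: "density_risk q pX (\<lambda>y x. g (y - x)) \<mu> = (\<integral>\<^sup>+t. ennreal (residual t) \<partial>lborel)" for \<mu>
    using equivariant_risk[OF eq] by simp
  have "(\<integral>\<^sup>+t. ennreal (residual t) \<partial>lborel) + ennreal (2 * overlap (\<lambda>x. x) 0) = energy"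
    using density_risk_plug_in[of "\<lambda>x. x" 0] unfolding risk by simp
  then have "(\<integral>\<^sup>+t. ennreal (residual t) \<partial>lborel) \<le> energy"
    by (metis le_iff_add)
  then have fin: "(\<integral>\<^sup>+t. ennreal (residual t) \<partial>lborel) < \<infinity>"
    using energy_finite by (rule le_less_trans)
  show ?thesis
    unfolding is_MRE_def
  proof (intro conjI allI impI eq)
    fix e :: "'a \<Rightarrow> 'a \<Rightarrow> real" and \<mu> assume e: "equivariant_estimator e"
    show "density_risk q pX (\<lambda>y x. g (y - x)) \<mu> \<le> density_risk q pX e \<mu>"
      by (simp add: risk equivariant_risk[OF e])
  next
    fix e :: "'a \<Rightarrow> 'a \<Rightarrow> real" and x assume e: "equivariant_estimator e"
      and same: "\<forall>\<mu>. density_risk q pX e \<mu> = density_risk q pX (\<lambda>y x. g (y - x)) \<mu>"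
    have meas [measurable]: "(\<lambda>(y, x). e y x) \<in> borel_measurable (borel \<Otimes>\<^sub>M borel)"
      using e by (simp add: equivariant_estimator_def density_estimator_def)
    have [measurable]: "(\<lambda>t. e t 0) \<in> borel_measurable borel"
      by measurable
    have "(\<integral>\<^sup>+t. ennreal ((g t - e t 0)\<^sup>2) \<partial>lborel) = 0"
    proof -
      have "(\<integral>\<^sup>+t. ennreal (residual t) \<partial>lborel) + (\<integral>\<^sup>+t. ennreal ((g t - e t 0)\<^sup>2) \<partial>lborel)
          = (\<integral>\<^sup>+t. ennreal (residual t) \<partial>lborel) + 0"
        using same by (simp add: risk equivariant_risk[OF e])
      then show ?thesis using fin by (simp only: ennreal_add_left_cancel) auto
    qed
    then have "AE t in lborel. e t 0 = g t"
      by (subst (asm) nn_integral_0_iff_AE) (auto elim!: eventually_mono simp: ennreal_eq_0_iff)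
    then have "AE y in lborel. e (y - x) 0 = g (y - x)"
      by (intro AE_lborel_translate) measurable
    then show "AE y in lborel. e y x = g (y - x)"
      using e by (simp add: equivariant_estimator_def)
  qed
qed

end

section \<open>Tangent inequality for the exponential\<close>

lemma one_add_less_exp: "(u::real) \<noteq> 0 \<Longrightarrow> 1 + u < exp u"
proof -
  assume u: "u \<noteq> 0"
  show ?thesis
  proof (cases "1 + u / 2 \<ge> 0")
    case True
    have "(1 + u / 2)\<^sup>2 = 1 + u + u\<^sup>2 / 4"
      by (simp add: power2_eq_square field_simps)
    then have "1 + u < (1 + u / 2)\<^sup>2"
      using u by simp
    also have "\<dots> \<le> (exp (u / 2))\<^sup>2"
      using True exp_ge_add_one_self[of "u / 2"] by (intro power_mono) auto
    also have "\<dots> = exp u" by (simp flip: exp_double)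
    finally show ?thesis .
  next
    case False
    then have "1 + u < 0" by simp
    then show ?thesis using exp_gt_zero[of u] by linarith
  qed
qed

text \<open>Convexity of the exponential: the graph of \<open>exp (- s / (2 * t))\<close> lies above its tangent at
  \<open>s = (norm x)\<^sup>2\<close>, strictly off the point of contact. The slope, up to sign \<open>gauss t x / (2 * t)\<close>, becomes, after
  mixing over \<open>t\<close> and multiplication by \<open>pX\<close>, the density of the auxiliary model.\<close>

lemma gauss_tangent:
  fixes x y :: "'a::euclidean_space"
  assumes t: "0 < t"
  shows "gauss t x + (norm x)\<^sup>2 * (gauss t x / (2 * t)) \<le> gauss t y + (norm y)\<^sup>2 * (gauss t x / (2 * t))"
    and "norm x \<noteq> norm y \<Longrightarrow>
      gauss t x + (norm x)\<^sup>2 * (gauss t x / (2 * t)) < gauss t y + (norm y)\<^sup>2 * (gauss t x / (2 * t))"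
proof -
  define u where "u = (norm x)\<^sup>2 / (2 * t) - (norm y)\<^sup>2 / (2 * t)"
  have y: "gauss t y = gauss t x * exp u"
    by (simp add: gauss_def u_def mult.assoc flip: exp_add)
  have diff: "gauss t y + (norm y)\<^sup>2 * (gauss t x / (2 * t))
      - (gauss t x + (norm x)\<^sup>2 * (gauss t x / (2 * t))) = gauss t x * (exp u - (1 + u))"
    using t by (simp add: y u_def algebra_simps)
  have pos: "gauss t x > 0" using t by (rule gauss_pos)
  then have "0 \<le> gauss t x * (exp u - (1 + u))"
    using exp_ge_add_one_self[of u] by (intro mult_nonneg_nonneg) auto
  then show "gauss t x + (norm x)\<^sup>2 * (gauss t x / (2 * t)) \<le> gauss t y + (norm y)\<^sup>2 * (gauss t x / (2 * t))"
    unfolding diff[symmetric] by linarith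
  assume "norm x \<noteq> norm y"
  then have "u \<noteq> 0" using t by (auto simp: u_def)
  then have "0 < gauss t x * (exp u - (1 + u))"
    using pos one_add_less_exp[of u] by (intro mult_pos_pos) auto
  then show "gauss t x + (norm x)\<^sup>2 * (gauss t x / (2 * t)) < gauss t y + (norm y)\<^sup>2 * (gauss t x / (2 * t))"
    unfolding diff[symmetric] by linarith
qed

text \<open>From \<open>u * exp (- u) \<le> 1\<close>. It bounds the tangent correction at the observation itself, so the
  comparison below starts from finite quantities.\<close>

lemma gauss_second_moment_le:
  fixes x :: "'a::euclidean_space"
  assumes t: "0 < t"
  shows "(norm x)\<^sup>2 * (gauss t x / (2 * t))
           \<le> (2 * pi) powr (- (real DIM('a) / 2)) * t powr (- (real DIM('a) / 2))"
proof -
  define u where "u = (norm x)\<^sup>2 / (2 * t)"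
  have "u \<le> exp u"
    using exp_ge_add_one_self[of u] by linarith
  then have "u * exp (- u) \<le> exp u * exp (- u)"
    by (rule mult_right_mono) simp
  then have u: "u * exp (- u) \<le> 1" by (simp flip: exp_add)
  have "(norm x)\<^sup>2 * (gauss t x / (2 * t)) = (2 * pi * t) powr (- (real DIM('a) / 2)) * (u * exp (- u))"
    using t by (simp add: gauss_def u_def)
  also have "\<dots> \<le> (2 * pi * t) powr (- (real DIM('a) / 2))"
    using u by (intro mult_left_le) auto
  finally show ?thesis using t by (simp add: powr_mult)
qed

text \<open>The negative derivative of the mixture density with respect to the squared radius.\<close>

definition tangent_weight :: "real measure \<Rightarrow> 'a::euclidean_space \<Rightarrow> ennreal" where
  "tangent_weight L x = (\<integral>\<^sup>+t. ennreal (gauss t x / (2 * t)) \<partial>L)"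

lemma measurable_tangent_weight:
  assumes L: "positive_distribution L"
  shows "tangent_weight L \<in> borel_measurable borel"
proof -
  note [measurable_cong] = positive_distributionD(4)[OF L]
  interpret sigma_finite_measure L by (rule positive_distributionD[OF L])
  show ?thesis unfolding tangent_weight_def by measurable
qed

lemma tangent_weight_second_moment_le:
  fixes x :: "'a::euclidean_space"
  assumes L: "mixing_law DIM('a) L"
  shows "tangent_weight L x * ennreal ((norm x)\<^sup>2) \<le> ennreal (sn_bound DIM('a) L)"
proof -
  note Lp = mixing_law_positive[OF L]
  note [measurable_cong] = positive_distributionD(4)[OF Lp]
  have "tangent_weight L x * ennreal ((norm x)\<^sup>2)
      = (\<integral>\<^sup>+t. ennreal (gauss t x / (2 * t)) * ennreal ((norm x)\<^sup>2) \<partial>L)"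
    unfolding tangent_weight_def by (rule nn_integral_multc[symmetric]) simp
  also have "\<dots> \<le> (\<integral>\<^sup>+t. ennreal ((2 * pi) powr (- (real DIM('a) / 2)) * t powr (- (real DIM('a) / 2))) \<partial>L)"
  proof (rule nn_integral_mono_AE)
    show "AE t in L. ennreal (gauss t x / (2 * t)) * ennreal ((norm x)\<^sup>2)
        \<le> ennreal ((2 * pi) powr (- (real DIM('a) / 2)) * t powr (- (real DIM('a) / 2)))"
      using positive_distributionD(5)[OF Lp]
    proof eventually_elim
      case (elim t)
      show ?case using gauss_second_moment_le[OF elim, of x] elim
        by (simp add: mult.commute ennreal_leI flip: ennreal_mult)
    qed
  qed
  also have "\<dots> = ennreal (sn_bound DIM('a) L)"
    using L by (subst nn_integral_eq_integral) (auto simp: mixing_law_def sn_bound_def)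
  finally show ?thesis .
qed

lemma mix_tangent:
  fixes x y :: "'a::euclidean_space"
  assumes L: "mixing_law DIM('a) L"
  shows "mix L x + tangent_weight L x * ennreal ((norm x)\<^sup>2)
       \<le> mix L y + tangent_weight L x * ennreal ((norm y)\<^sup>2)"
    and "norm x \<noteq> norm y \<Longrightarrow> mix L x + tangent_weight L x * ennreal ((norm x)\<^sup>2)
       < mix L y + tangent_weight L x * ennreal ((norm y)\<^sup>2)"
proof -
  note Lp = mixing_law_positive[OF L]
  note [measurable_cong] = positive_distributionD(4)[OF Lp]
  interpret prob_space L by (rule positive_distributionD[OF Lp])
  let ?f = "\<lambda>y t. ennreal (gauss t y) + ennreal (gauss t x / (2 * t)) * ennreal ((norm y)\<^sup>2)"
  have f: "mix L y + tangent_weight L x * ennreal ((norm y)\<^sup>2) = (\<integral>\<^sup>+t. ?f y t \<partial>L)" for y :: 'a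
    unfolding mix_def tangent_weight_def by (simp add: nn_integral_add nn_integral_multc)
  have f_eq: "?f y t = ennreal (gauss t y + (norm y)\<^sup>2 * (gauss t x / (2 * t)))" if "0 < t" for y :: 'a and t
    using that by (simp add: ennreal_mult[symmetric] mult.commute flip: ennreal_plus)
  have le: "AE t in L. ?f x t \<le> ?f y t"
    using positive_distributionD(5)[OF Lp]
  proof eventually_elim
    case (elim t)
    show ?case unfolding f_eq[OF elim] by (intro ennreal_leI gauss_tangent(1) elim)
  qed
  show "mix L x + tangent_weight L x * ennreal ((norm x)\<^sup>2)
       \<le> mix L y + tangent_weight L x * ennreal ((norm y)\<^sup>2)"
    unfolding f using le by (rule nn_integral_mono_AE)
  assume ne: "norm x \<noteq> norm y"
  have "AE t in L. ?f x t < ?f y t"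
    using positive_distributionD(5)[OF Lp]
  proof eventually_elim
    case (elim t)
    have "0 \<le> gauss t x + (norm x)\<^sup>2 * (gauss t x / (2 * t))" using elim by simp
    then show ?case using gauss_tangent(2)[OF elim ne] elim
      by (simp only: f_eq ennreal_less_iff)
  qed
  then have nle: "\<not> (AE t in L. ?f y t \<le> ?f x t)"
  proof (intro notI)
    assume "AE t in L. ?f x t < ?f y t" "AE t in L. ?f y t \<le> ?f x t"
    then have "AE t in L. False" by eventually_elim simp
    then show False using AE_False by (auto simp: not_empty)
  qed
  have "mix L x + tangent_weight L x * ennreal ((norm x)\<^sup>2) \<le> ennreal (sn_bound DIM('a) L) + ennreal (sn_bound DIM('a) L)"
    by (intro add_mono mix_le tangent_weight_second_moment_le L)
  also have "\<dots> < \<infinity>" by simp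
  finally have "(\<integral>\<^sup>+t. ?f x t \<partial>L) \<noteq> \<infinity>" unfolding f by simp
  then show "mix L x + tangent_weight L x * ennreal ((norm x)\<^sup>2)
       < mix L y + tangent_weight L x * ennreal ((norm y)\<^sup>2)"
    unfolding f using le nle by (intro nn_integral_less) auto
qed

section \<open>The law of Z and squared-error risk\<close>
lemma inverse_sqrt_moment:
  assumes L: "mixing_law p L" and p: "1 \<le> p"
  shows "(\<integral>\<^sup>+v. ennreal (v powr (- (1 / 2))) \<partial>L) < \<infinity>"
proof -
  note Lp = mixing_law_positive[OF L]
  note [measurable_cong] = positive_distributionD(4)[OF Lp]
  interpret prob_space L by (rule positive_distributionD[OF Lp])
  \<comment> \<open>Small scales are controlled by the higher negative moment, large ones by the constant.\<close>
  have le: "v powr (- (1 / 2)) \<le> 1 + v powr (- (real p / 2))" if "0 < v" for v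
  proof (cases "v \<le> 1")
    case True
    then have "v powr (- (1 / 2)) \<le> v powr (- (real p / 2))"
      using that p by (intro powr_mono') auto
    then show ?thesis by simp
  next
    case False
    then have "v powr (- (1 / 2)) \<le> v powr 0" by (intro powr_mono) auto
    then show ?thesis using that by (simp add: add_increasing2)
  qed
  have "(\<integral>\<^sup>+v. ennreal (v powr (- (1 / 2))) \<partial>L) \<le> (\<integral>\<^sup>+v. ennreal (1 + v powr (- (real p / 2))) \<partial>L)"
    using positive_distributionD(5)[OF Lp]
    by (intro nn_integral_mono_AE) (auto elim!: eventually_mono intro!: ennreal_leI le simp del: ennreal_plus)
  also have "\<dots> < \<infinity>"
    using L by (subst nn_integral_eq_integral) (auto simp: mixing_law_def)
  finally show ?thesis .
qed

text \<open>Separates the three variables so that the total mass factorises. The factor \<open>1 / (s + w)\<close> is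
  shared between two independent scales by the inequality of arithmetic and geometric means: each
  receives order \<open>- 1 / 2\<close>, which a law with a moment of order \<open>- p / 2\<close> and \<open>p \<ge> 1\<close> can afford.\<close>

lemma tau_weight_le:
  assumes "0 < v" "0 < s" "0 < w"
  shows "tau_weight p (v, s + w) \<le> v powr (- (real p / 2)) * (s powr (- (1 / 2)) * w powr (- (1 / 2)))"
proof -
  have "(s * w) powr (1 / 2) = sqrt (s * w)"
    using assms by (simp add: powr_half_sqrt)
  also have "\<dots> \<le> (s + w) / 2" using assms by (intro arith_geo_mean_sqrt) auto
  also have "\<dots> \<le> s + w" using assms by simp
  finally have 1: "1 / (s + w) \<le> s powr (- (1 / 2)) * w powr (- (1 / 2))"
    using assms by (simp add: powr_minus_divide powr_mult field_simps)
  have 2: "1 / (v + (s + w)) powr (real p / 2) \<le> v powr (- (real p / 2))"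
    using assms by (simp add: powr_minus_divide[symmetric] powr_mono2')
  have "tau_weight p (v, s + w) = 1 / (v + (s + w)) powr (real p / 2) * (1 / (s + w))"
    by (simp add: tau_weight_def)
  also have "\<dots> \<le> v powr (- (real p / 2)) * (s powr (- (1 / 2)) * w powr (- (1 / 2)))"
    using 1 2 assms by (intro mult_mono) auto
  finally show ?thesis .
qed

context scale_mixture_model
begin

definition FZ :: "real measure" where "FZ = Z_law DIM('a) G J"
definition tau_mass :: ennreal where
  "tau_mass = (\<integral>\<^sup>+z. ennreal (tau_weight DIM('a) z) \<partial>(G \<Otimes>\<^sub>M J))"

lemmas pos_G = mixing_law_positive[OF G] and pos_H = mixing_law_positive[OF H]
  and pos_F = mixing_law_positive[OF F] and pos_J = mixing_law_positive[OF J]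

lemmas sets_laws [measurable_cong] =
  positive_distributionD(4)[OF pos_G] positive_distributionD(4)[OF pos_H]
  positive_distributionD(4)[OF pos_F] positive_distributionD(4)[OF pos_J]

lemma measurable_tau_weight [measurable]: "tau_weight p \<in> borel_measurable (borel \<Otimes>\<^sub>M borel)"
  unfolding tau_weight_def by measurable

sublocale G: prob_space G by (rule positive_distributionD[OF pos_G])
sublocale J: prob_space J by (rule positive_distributionD[OF pos_J])
sublocale GJ: pair_prob_space G J ..

lemma AE_GJ_pos: "AE z in G \<Otimes>\<^sub>M J. 0 < fst z \<and> 0 < snd z"
proof -
  have "AE v in G. AE t in J. 0 < v \<and> 0 < t"
    using positive_distributionD(5)[OF pos_G]
  proof eventually_elim
    case (elim v)
    show ?case using positive_distributionD(5)[OF pos_J] by eventually_elim (use elim in simp)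
  qed
  then show ?thesis by (intro GJ.AE_pair_measure) auto
qed

lemma tau_mass_iterated:
  "tau_mass = (\<integral>\<^sup>+v. \<integral>\<^sup>+t. ennreal (tau_weight DIM('a) (v, t)) \<partial>J \<partial>G)"
  unfolding tau_mass_def by (rule J.nn_integral_fst[symmetric]) measurable

lemma tau_mass_finite: "tau_mass < \<infinity>"
proof -
  let ?h = "\<lambda>L. \<integral>\<^sup>+v. ennreal (v powr (- (1 / 2))) \<partial>L"
  let ?m = "\<lambda>v. v powr (- (real DIM('a) / 2))"
  have one: "1 \<le> DIM('a)" by (simp add: Suc_le_eq)
  interpret F: prob_space F by (rule positive_distributionD[OF pos_F])
  interpret H: prob_space H by (rule positive_distributionD[OF pos_H])
  have "tau_mass = (\<integral>\<^sup>+v. \<integral>\<^sup>+s. \<integral>\<^sup>+w. ennreal (tau_weight DIM('a) (v, s + w)) \<partial>H \<partial>F \<partial>G)"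
    unfolding tau_mass_iterated J_def
    using positive_distributionD(3,4)[OF pos_F] positive_distributionD(3,4)[OF pos_H]
    by (intro nn_integral_cong nn_integral_convolution) auto
  also have "\<dots> \<le> (\<integral>\<^sup>+v. \<integral>\<^sup>+s. \<integral>\<^sup>+w. ennreal (?m v) * (ennreal (s powr (- (1 / 2))) * ennreal (w powr (- (1 / 2)))) \<partial>H \<partial>F \<partial>G)"
  proof (rule nn_integral_mono_AE, use positive_distributionD(5)[OF pos_G] in eventually_elim)
    fix v :: real assume v: "0 < v"
    show "(\<integral>\<^sup>+s. \<integral>\<^sup>+w. ennreal (tau_weight DIM('a) (v, s + w)) \<partial>H \<partial>F)
        \<le> (\<integral>\<^sup>+s. \<integral>\<^sup>+w. ennreal (?m v) * (ennreal (s powr (- (1 / 2))) * ennreal (w powr (- (1 / 2)))) \<partial>H \<partial>F)"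
    proof (rule nn_integral_mono_AE, use positive_distributionD(5)[OF pos_F] in eventually_elim)
      fix s :: real assume s: "0 < s"
      show "(\<integral>\<^sup>+w. ennreal (tau_weight DIM('a) (v, s + w)) \<partial>H)
        \<le> (\<integral>\<^sup>+w. ennreal (?m v) * (ennreal (s powr (- (1 / 2))) * ennreal (w powr (- (1 / 2)))) \<partial>H)"
      proof (rule nn_integral_mono_AE, use positive_distributionD(5)[OF pos_H] in eventually_elim)
        fix w :: real assume w: "0 < w"
        show "ennreal (tau_weight DIM('a) (v, s + w))
          \<le> ennreal (?m v) * (ennreal (s powr (- (1 / 2))) * ennreal (w powr (- (1 / 2))))"
          using tau_weight_le[OF v s w] by (simp add: ennreal_leI flip: ennreal_mult)
      qed
    qed
  qed
  also have "\<dots> = (\<integral>\<^sup>+v. ennreal (?m v) \<partial>G) * (?h F * ?h H)"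
    by (simp add: nn_integral_cmult nn_integral_multc)
  also have "\<dots> < \<infinity>"
    using inverse_sqrt_moment[OF F one] inverse_sqrt_moment[OF H one] G
    by (subst nn_integral_eq_integral) (auto simp: mixing_law_def ennreal_mult_less_top)
  finally show ?thesis .
qed

lemma tau_mass_nonzero: "tau_mass \<noteq> 0"
proof
  assume "tau_mass = 0"
  then have "AE z in G \<Otimes>\<^sub>M J. ennreal (tau_weight DIM('a) z) = 0"
    unfolding tau_mass_def by (subst (asm) nn_integral_0_iff_AE) auto
  with AE_GJ_pos have "AE z in G \<Otimes>\<^sub>M J. False"
  proof eventually_elim
    case (elim z)
    then have "0 < tau_weight DIM('a) z" by (cases z) (simp add: tau_weight_def)
    with elim show ?case by (simp add: ennreal_eq_0_iff)
  qed
  then show False using GJ.AE_False by (auto simp: GJ.not_empty)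
qed

text \<open>The normalisation is multiplied out, so that later identities need no division.\<close>

lemma nn_integral_FZ:
  assumes [measurable]: "f \<in> borel_measurable borel"
  shows "tau_mass * (\<integral>\<^sup>+z. f z \<partial>FZ)
       = (\<integral>\<^sup>+v. \<integral>\<^sup>+t. ennreal (tau_weight DIM('a) (v, t)) * f (v * t / (v + t)) \<partial>J \<partial>G)"
proof -
  let ?w = "\<lambda>z. ennreal (tau_weight DIM('a) z)"
  let ?k = "\<lambda>(z1, z2). z1 * z2 / (z1 + z2) :: real"
  have "(\<integral>\<^sup>+z. f z \<partial>FZ) = (\<integral>\<^sup>+z. ?w z / tau_mass * f (?k z) \<partial>(G \<Otimes>\<^sub>M J))"
    unfolding FZ_def Z_law_def tau_def tau_mass_def
    by (simp add: nn_integral_distr nn_integral_density)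
  then have "tau_mass * (\<integral>\<^sup>+z. f z \<partial>FZ) = (\<integral>\<^sup>+z. tau_mass * (?w z / tau_mass * f (?k z)) \<partial>(G \<Otimes>\<^sub>M J))"
    by (simp add: nn_integral_cmult)
  also have "\<dots> = (\<integral>\<^sup>+z. ?w z * f (?k z) \<partial>(G \<Otimes>\<^sub>M J))"
  proof (intro nn_integral_cong)
    fix z
    have "tau_mass * (?w z / tau_mass) = ?w z"
      using tau_mass_finite tau_mass_nonzero
      by (simp add: ennreal_times_divide mult.commute[of tau_mass] ennreal_mult_divide_eq)
    then show "tau_mass * (?w z / tau_mass * f (?k z)) = ?w z * f (?k z)"
      by (simp add: mult.assoc[symmetric])
  qed
  also have "\<dots> = (\<integral>\<^sup>+v. \<integral>\<^sup>+t. ?w (v, t) * f (?k (v, t)) \<partial>J \<partial>G)"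
    by (rule J.nn_integral_fst[symmetric]) measurable
  finally show ?thesis by simp
qed

lemma FZ_positive: "positive_distribution FZ"
proof -
  have sets: "sets FZ = sets borel" "space FZ = UNIV"
    by (simp_all add: FZ_def Z_law_def)
  note [measurable_cong] = sets(1)
  have "tau_mass * (\<integral>\<^sup>+z. 1 \<partial>FZ) = tau_mass * 1"
    by (subst nn_integral_FZ) (simp_all add: tau_mass_iterated)
  then have "(\<integral>\<^sup>+z. 1 \<partial>FZ) = 1"
    using tau_mass_finite tau_mass_nonzero by (subst (asm) ennreal_mult_cancel_left) auto
  then have "prob_space FZ" by (intro prob_spaceI) simp
  moreover have "AE z in FZ. 0 < z"
  proof -
    have "tau_mass * (\<integral>\<^sup>+z. indicator {..0} z \<partial>FZ) =
      (\<integral>\<^sup>+v. \<integral>\<^sup>+t. ennreal (tau_weight DIM('a) (v, t)) * indicator {..0} (v * t / (v + t)) \<partial>J \<partial>G)"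
      by (rule nn_integral_FZ) simp
    also have "\<dots> = (\<integral>\<^sup>+v. \<integral>\<^sup>+t. 0 \<partial>J \<partial>G)"
    proof (rule nn_integral_cong_AE, use positive_distributionD(5)[OF pos_G] in eventually_elim)
      fix v :: real assume v: "0 < v"
      show "(\<integral>\<^sup>+t. ennreal (tau_weight DIM('a) (v, t)) * indicator {..0} (v * t / (v + t)) \<partial>J)
          = (\<integral>\<^sup>+t. 0 \<partial>J)"
      proof (rule nn_integral_cong_AE, use positive_distributionD(5)[OF pos_J] in eventually_elim)
        fix t :: real assume t: "0 < t"
        have "0 < v * t / (v + t)" using v t by simp
        then show "ennreal (tau_weight DIM('a) (v, t)) * indicator {..0} (v * t / (v + t)) = 0"
          by simp
      qed
    qed
    finally have "emeasure FZ {..0} = 0"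
      using tau_mass_nonzero by (simp add: nn_integral_indicator)
    then have "AE z in FZ. z \<notin> {..0}"
      by (intro AE_not_in) (auto simp: null_sets_def)
    then show ?thesis by (simp add: not_le)
  qed
  ultimately show ?thesis using sets
    by (simp add: positive_distribution_def real_distribution_def real_distribution_axioms_def)
qed

definition Z_scale :: ennreal where
  "Z_scale = ennreal ((2 * pi) powr (- (real DIM('a) / 2)) / 2) * tau_mass"

lemma Z_scale: "Z_scale \<noteq> 0" "Z_scale < \<infinity>"
  using tau_mass_finite tau_mass_nonzero by (simp_all add: Z_scale_def ennreal_mult_less_top)

text \<open>Why \<open>Z\<close> has the law it has: multiplying the kernel of variance \<open>v\<close> by that of variance \<open>t\<close> gives the
  kernel of variance \<open>v * t / (v + t)\<close> times a power of \<open>v + t\<close>, and this power together with the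
  slope factor \<open>1 / t\<close> is the weight of \<^const>\<open>tau\<close>.\<close>

lemma mix_mult_tangent_weight:
  "mix G x * tangent_weight J x = Z_scale * mix FZ (x :: 'a)"
proof -
  have id: "ennreal (gauss v x) * ennreal (gauss t x / (2 * t))
      = ennreal ((2 * pi) powr (- (real DIM('a) / 2)) / 2)
        * (ennreal (tau_weight DIM('a) (v, t)) * ennreal (gauss (v * t / (v + t)) x))"
    if v: "0 < v" and t: "0 < t" for v t
  proof -
    have "gauss v x * gauss t x = gauss (v * t / (v + t)) x * gauss (v + t) (0::'a)"
      using gauss_mult[OF v t, of x 0 0] by simp
    moreover have "gauss (v + t) (0::'a)
       = (2 * pi) powr (- (real DIM('a) / 2)) * (1 / (v + t) powr (real DIM('a) / 2))"
      using v t by (simp add: gauss_def powr_mult powr_minus_divide)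
    ultimately have "gauss v x * (gauss t x / (2 * t))
      = (2 * pi) powr (- (real DIM('a) / 2)) / 2 * (tau_weight DIM('a) (v, t) * gauss (v * t / (v + t)) x)"
      using t by (simp add: tau_weight_def mult_ac)
    moreover have "0 \<le> tau_weight DIM('a) (v, t)" using t by (simp add: tau_weight_def)
    ultimately show ?thesis using t by (simp flip: ennreal_mult)
  qed
  have "mix G x * tangent_weight J x
      = (\<integral>\<^sup>+v. \<integral>\<^sup>+t. ennreal (gauss v x) * ennreal (gauss t x / (2 * t)) \<partial>J \<partial>G)"
    unfolding mix_def tangent_weight_def by (simp add: nn_integral_cmult nn_integral_multc)
  also have "\<dots> = (\<integral>\<^sup>+v. \<integral>\<^sup>+t. ennreal ((2 * pi) powr (- (real DIM('a) / 2)) / 2)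
        * (ennreal (tau_weight DIM('a) (v, t)) * ennreal (gauss (v * t / (v + t)) x)) \<partial>J \<partial>G)"
  proof (rule nn_integral_cong_AE, use positive_distributionD(5)[OF pos_G] in eventually_elim)
    fix v :: real assume v: "0 < v"
    show "(\<integral>\<^sup>+t. ennreal (gauss v x) * ennreal (gauss t x / (2 * t)) \<partial>J)
      = (\<integral>\<^sup>+t. ennreal ((2 * pi) powr (- (real DIM('a) / 2)) / 2)
        * (ennreal (tau_weight DIM('a) (v, t)) * ennreal (gauss (v * t / (v + t)) x)) \<partial>J)"
      using positive_distributionD(5)[OF pos_J]
      by (intro nn_integral_cong_AE) (auto elim!: eventually_mono intro: id[OF v])
  qed
  also have "\<dots> = ennreal ((2 * pi) powr (- (real DIM('a) / 2)) / 2) * (tau_mass * mix FZ x)"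
    unfolding mix_def by (subst nn_integral_FZ) (simp_all add: nn_integral_cmult)
  finally show ?thesis by (simp add: Z_scale_def mult.assoc)
qed

definition sq_risk :: "('a \<Rightarrow> 'a) \<Rightarrow> 'a \<Rightarrow> ennreal" where
  "sq_risk m \<mu> = (\<integral>\<^sup>+x. mix FZ (x - \<mu>) * ennreal ((norm (m x - \<mu>))\<^sup>2) \<partial>lborel)"

lemma measurable_mix_FZ [measurable]: "(mix FZ :: 'a \<Rightarrow> ennreal) \<in> borel_measurable borel"
  by (rule measurable_mix[OF FZ_positive])

lemma measurable_tangent_weight_J [measurable]:
  "(tangent_weight J :: 'a \<Rightarrow> ennreal) \<in> borel_measurable borel"
  by (rule measurable_tangent_weight[OF pos_J])

lemma overlap_plus_sq_risk:
  assumes [measurable]: "m \<in> borel_measurable borel"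
  shows "ennreal (overlap m \<mu>) + Z_scale * sq_risk m \<mu>
       = (\<integral>\<^sup>+x. mix G (x - \<mu>) * (mix J (m x - \<mu>)
            + tangent_weight J (x - \<mu>) * ennreal ((norm (m x - \<mu>))\<^sup>2)) \<partial>lborel)"
proof -
  have "ennreal (overlap m \<mu>) = (\<integral>\<^sup>+x. mix G (x - \<mu>) * mix J (m x - \<mu>) \<partial>lborel)"
    by (simp add: overlap(2)[symmetric] nn_integral_P mix_mixing_law[OF J])
  moreover have "Z_scale * sq_risk m \<mu>
      = (\<integral>\<^sup>+x. mix G (x - \<mu>) * (tangent_weight J (x - \<mu>) * ennreal ((norm (m x - \<mu>))\<^sup>2)) \<partial>lborel)"
    unfolding sq_risk_def
    by (subst nn_integral_cmult[symmetric]) (simp_all add: mult.assoc[symmetric] mix_mult_tangent_weight)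
  ultimately show ?thesis
    by (simp add: distrib_left nn_integral_add)
qed

lemma overlap_plus_sq_risk_identity_finite:
  "ennreal (overlap (\<lambda>x. x) \<mu>) + Z_scale * sq_risk (\<lambda>x. x) \<mu> < \<infinity>"
proof -
  have "ennreal (overlap (\<lambda>x. x) \<mu>) + Z_scale * sq_risk (\<lambda>x. x) \<mu>
      \<le> (\<integral>\<^sup>+x. mix G (x - \<mu>) * (ennreal (sn_bound DIM('a) J) + ennreal (sn_bound DIM('a) J)) \<partial>lborel)"
    by (subst overlap_plus_sq_risk)
       (auto intro!: nn_integral_mono mult_left_mono add_mono mix_le tangent_weight_second_moment_le J)
  also have "\<dots> = ennreal (sn_bound DIM('a) J) + ennreal (sn_bound DIM('a) J)"
    by (subst nn_integral_multc) (simp_all add: nn_integral_mix[OF pos_G])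
  also have "\<dots> < \<infinity>" by simp
  finally show ?thesis .
qed

text \<open>The tangent inequality integrated against \<open>pX\<close>: up to the factor \<open>Z_scale\<close>, a decrease of the
  squared-error risk in the auxiliary model is bounded by the increase of the overlap.\<close>

lemma overlap_sq_risk_le:
  assumes [measurable]: "m \<in> borel_measurable borel"
  shows "ennreal (overlap (\<lambda>x. x) \<mu>) + Z_scale * sq_risk (\<lambda>x. x) \<mu>
       \<le> ennreal (overlap m \<mu>) + Z_scale * sq_risk m \<mu>"
proof -
  have id: "(\<lambda>x::'a. x) \<in> borel_measurable borel" by simp
  show ?thesis
    unfolding overlap_plus_sq_risk[OF assms] overlap_plus_sq_risk[OF id]
    by (intro nn_integral_mono mult_left_mono mix_tangent J) auto
qed

text \<open>Strict convexity is a second source of improvement. It makes the overlap strictly larger even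
  where the squared-error risks agree.\<close>

lemma overlap_sq_risk_less:
  assumes [measurable]: "m \<in> borel_measurable borel"
    and ne: "\<not> (AE x in lborel. norm (m x - \<mu>) = norm (x - \<mu>))"
  shows "ennreal (overlap (\<lambda>x. x) \<mu>) + Z_scale * sq_risk (\<lambda>x. x) \<mu>
       < ennreal (overlap m \<mu>) + Z_scale * sq_risk m \<mu>"
proof -
  let ?f = "\<lambda>m x. mix G (x - \<mu>) * (mix J (m x - \<mu>) + tangent_weight J (x - \<mu>) * ennreal ((norm (m x - \<mu>))\<^sup>2))"
  have pos: "mix G (x - \<mu>) \<noteq> 0" for x
  proof
    assume "mix G (x - \<mu>) = 0"
    then have "AE v in G. ennreal (gauss v (x - \<mu>)) = 0"
      unfolding mix_def by (subst (asm) nn_integral_0_iff_AE) auto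
    with positive_distributionD(5)[OF pos_G] have "AE v in G. False"
    proof eventually_elim
      case (elim v)
      with gauss_pos[OF elim(1), of "x - \<mu>"] show ?case by (simp add: ennreal_eq_0_iff)
    qed
    then show False using G.AE_False by (auto simp: G.not_empty)
  qed
  have less: "?f (\<lambda>x. x) x < ?f m x" if "norm (m x - \<mu>) \<noteq> norm (x - \<mu>)" for x
  proof -
    have "mix G (x - \<mu>) < \<infinity>" by (simp add: mix_mixing_law[OF G])
    then show ?thesis
      using mix_tangent(2)[OF J, of "x - \<mu>" "m x - \<mu>"] that pos[of x]
      by (intro ennreal_mult_strict_left_mono) (auto simp: zero_less_iff_neq_zero)
  qed
  have id: "(\<lambda>x::'a. x) \<in> borel_measurable borel" by simp
  show ?thesis
    unfolding overlap_plus_sq_risk[OF assms(1)] overlap_plus_sq_risk[OF id]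
  proof (rule nn_integral_less)
    show "\<not> (AE x in lborel. ?f m x \<le> ?f (\<lambda>x. x) x)"
    proof
      assume "AE x in lborel. ?f m x \<le> ?f (\<lambda>x. x) x"
      then have "AE x in lborel. norm (m x - \<mu>) = norm (x - \<mu>)"
        by eventually_elim (metis less leD)
      with ne show False ..
    qed
    show "(\<integral>\<^sup>+x. ?f (\<lambda>x. x) x \<partial>lborel) \<noteq> \<infinity>"
      using overlap_plus_sq_risk_identity_finite[of \<mu>] unfolding overlap_plus_sq_risk[OF id] by simp
    show "AE x in lborel. ?f (\<lambda>x. x) x \<le> ?f m x"
      by (intro AE_I2 mult_left_mono mix_tangent J) auto
  qed measurable
qed

lemma overlap_mono_sq_risk:
  assumes m: "m \<in> borel_measurable borel"
  shows "sq_risk m \<mu> \<le> sq_risk (\<lambda>x. x) \<mu> \<Longrightarrow> overlap (\<lambda>x. x) \<mu> \<le> overlap m \<mu>"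
    and "sq_risk m \<mu> < sq_risk (\<lambda>x. x) \<mu> \<Longrightarrow> overlap (\<lambda>x. x) \<mu> < overlap m \<mu>"
    and "sq_risk m \<mu> \<le> sq_risk (\<lambda>x. x) \<mu> \<Longrightarrow> \<not> (AE x in lborel. norm (m x - \<mu>) = norm (x - \<mu>))
      \<Longrightarrow> overlap (\<lambda>x. x) \<mu> < overlap m \<mu>"
proof -
  let ?c = "Z_scale * sq_risk m \<mu>" and ?d = "Z_scale * sq_risk (\<lambda>x. x) \<mu>"
  have d: "?d < \<infinity>"
    using overlap_plus_sq_risk_identity_finite[of \<mu>] by (simp add: less_top)
  have nn: "0 \<le> overlap (\<lambda>x. x) \<mu>" "0 \<le> overlap m \<mu>"
    using m by (simp_all add: overlap(3))
  obtain d' where d': "?d = ennreal d'" "0 \<le> d'"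
    using d by (cases ?d) auto
  have ex: "\<exists>c'. ?c = ennreal c' \<and> 0 \<le> c' \<and> c' \<le> d' \<and> overlap (\<lambda>x. x) \<mu> + d' \<le> overlap m \<mu> + c'"
    if "sq_risk m \<mu> \<le> sq_risk (\<lambda>x. x) \<mu>"
  proof -
    have c: "?c \<le> ?d" using that by (rule mult_left_mono) simp
    with d have "?c < \<infinity>" by (rule le_less_trans[rotated])
    then obtain c' where c': "?c = ennreal c'" "0 \<le> c'" by (cases ?c) auto
    have "ennreal (overlap (\<lambda>x. x) \<mu> + d') \<le> ennreal (overlap m \<mu> + c')"
      using overlap_sq_risk_le[OF m, of \<mu>] c' d' nn by simp
    then have "overlap (\<lambda>x. x) \<mu> + d' \<le> overlap m \<mu> + c'"
      using c' nn by (subst (asm) ennreal_le_iff) auto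
    moreover have "c' \<le> d'" using c c' d' by (simp add: ennreal_le_iff)
    ultimately show ?thesis using c' by blast
  qed
  show "overlap (\<lambda>x. x) \<mu> \<le> overlap m \<mu>" if "sq_risk m \<mu> \<le> sq_risk (\<lambda>x. x) \<mu>"
    using ex[OF that] by force
  show "overlap (\<lambda>x. x) \<mu> < overlap m \<mu>" if less: "sq_risk m \<mu> < sq_risk (\<lambda>x. x) \<mu>"
  proof -
    obtain c' where c': "?c = ennreal c'" "0 \<le> c'" "overlap (\<lambda>x. x) \<mu> + d' \<le> overlap m \<mu> + c'"
      using ex[OF less_imp_le[OF less]] by blast
    have "?c < ?d" using less Z_scale
      by (intro ennreal_mult_strict_left_mono) (auto simp: zero_less_iff_neq_zero)
    then have "c' < d'" using c' d' by (simp add: ennreal_less_iff)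
    then show ?thesis using c'(3) by linarith
  qed
  show "overlap (\<lambda>x. x) \<mu> < overlap m \<mu>"
    if le: "sq_risk m \<mu> \<le> sq_risk (\<lambda>x. x) \<mu>"
      and ne: "\<not> (AE x in lborel. norm (m x - \<mu>) = norm (x - \<mu>))"
  proof -
    obtain c' where c': "?c = ennreal c'" "0 \<le> c'" "c' \<le> d'"
      using ex[OF le] by blast
    have "ennreal (overlap (\<lambda>x. x) \<mu> + d') < ennreal (overlap m \<mu> + c')"
      using overlap_sq_risk_less[OF m ne] c' d' nn by simp
    then have "overlap (\<lambda>x. x) \<mu> + d' < overlap m \<mu> + c'"
      using d' nn by (subst (asm) ennreal_less_iff) auto
    then show ?thesis using c'(3) by linarith
  qed
qed

lemma point_risk_sq_risk:
  assumes [measurable]: "m \<in> borel_measurable borel"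
  shows "point_risk (sn_density FZ) (\<lambda>d \<mu>. (norm (d - \<mu>))\<^sup>2) m \<mu> = enn2ereal (sq_risk m \<mu>)"
proof -
  note [measurable] = measurable_sn_density[OF FZ_positive]
  have "AE x in lborel. ennreal (sn_density FZ (x - \<mu>)) = mix FZ (x - \<mu>)"
    by (rule AE_lborel_translate[OF _ AE_sn_density_eq_mix[OF FZ_positive]]) measurable
  then have "(\<integral>\<^sup>+x. ennreal ((norm (m x - \<mu>))\<^sup>2) \<partial>location_law (sn_density FZ) \<mu>) = sq_risk m \<mu>"
    unfolding location_law_def sq_risk_def
    by (subst nn_integral_density) (auto intro!: nn_integral_cong_AE elim!: eventually_mono)
  moreover have "(\<integral>\<^sup>+x. ennreal (- (norm (m x - \<mu>))\<^sup>2) \<partial>location_law (sn_density FZ) \<mu>) = 0"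
    by (simp add: ennreal_neg)
  ultimately show ?thesis
    by (simp add: point_risk_def ext_expectation_def zero_ennreal.rep_eq)
qed

theorem squared_error_dominance_transfers:
  assumes m: "m \<in> borel_measurable borel"
    and dom: "point_dominates (sn_density FZ) (\<lambda>d \<mu>. (norm (d - \<mu>))\<^sup>2) m (\<lambda>x. x)"
  shows "density_dominates q pX (\<lambda>y x. g (y - m x)) (\<lambda>y x. g (y - x))"
proof -
  have "\<forall>\<mu>. sq_risk m \<mu> \<le> sq_risk (\<lambda>x. x) \<mu>" "\<exists>\<mu>. sq_risk m \<mu> < sq_risk (\<lambda>x. x) \<mu>"
    using dom m by (simp_all add: point_dominates_def risk_dominates_def point_risk_sq_risk
        less_eq_ennreal.rep_eq less_ennreal.rep_eq)
  then show ?thesis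
    unfolding density_dominates_iff_overlap[OF m measurable_ident_sets[OF refl]]
    using overlap_mono_sq_risk(1,2)[OF m] by blast
qed

end

section \<open>Gaussian averages of radial functions decrease with the shift\<close>
text \<open>The substitution is the reflection in the hyperplane \<open>x \<bullet> b = c\<close>. For basis vectors it is a diagonal
  affine map, hence covered by the product structure of Lebesgue measure.\<close>

lemma nn_integral_reflect:
  fixes f :: "'a::euclidean_space \<Rightarrow> ennreal"
  assumes [measurable]: "f \<in> borel_measurable borel" and b: "b \<in> Basis"
  shows "(\<integral>\<^sup>+x. f (x + (2 * (c - x \<bullet> b)) *\<^sub>R b) \<partial>lborel) = (\<integral>\<^sup>+x. f x \<partial>lborel)"
proof -
  define e :: "'a \<Rightarrow> real" where "e j = (if j = b then - 1 else 1)" for j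
  have T: "(2 * c) *\<^sub>R b + (\<Sum>j\<in>Basis. (e j * (x \<bullet> j)) *\<^sub>R j) = x + (2 * (c - x \<bullet> b)) *\<^sub>R b" for x
  proof -
    have "(\<Sum>j\<in>Basis. (e j * (x \<bullet> j)) *\<^sub>R j)
        = (\<Sum>j\<in>Basis. (x \<bullet> j) *\<^sub>R j - (if j = b then (2 * (x \<bullet> b)) *\<^sub>R b else 0))"
      by (intro sum.cong) (auto simp: e_def simp flip: scaleR_diff_left)
    also have "\<dots> = x - (2 * (x \<bullet> b)) *\<^sub>R b"
      using b by (simp add: sum_subtractf euclidean_representation)
    finally show ?thesis by (simp add: algebra_simps)
  qed
  have "lborel = density (distr lborel borel (\<lambda>x. (2 * c) *\<^sub>R b + (\<Sum>j\<in>Basis. (e j * (x \<bullet> j)) *\<^sub>R j)))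
      (\<lambda>_. ennreal (\<Prod>j\<in>Basis. \<bar>e j\<bar>))"
    by (rule lborel_affine_euclidean) (simp add: e_def)
  also have "(\<Prod>j\<in>Basis. \<bar>e j\<bar>) = 1" by (intro prod.neutral) (simp add: e_def)
  finally have "lborel = distr lborel borel (\<lambda>x. x + (2 * (c - x \<bullet> b)) *\<^sub>R b)"
    by (simp add: T density_1)
  then have "(\<integral>\<^sup>+x. f x \<partial>lborel) = (\<integral>\<^sup>+x. f x \<partial>distr lborel borel (\<lambda>x. x + (2 * (c - x \<bullet> b)) *\<^sub>R b))"
    by (rule arg_cong[where f = "\<lambda>M. integral\<^sup>N M f"])
  then show ?thesis by (simp add: nn_integral_distr)
qed

lemma ennreal_rearrangement:
  fixes a a' p p' :: ennreal
  assumes "a' \<le> a" "p' \<le> p"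
  shows "a * p' + a' * p \<le> a * p + a' * p'"
proof -
  obtain s r where "a = a' + s" "p = p' + r" using assms by (metis le_iff_add)
  then have "a * p + a' * p' = (a * p' + a' * p) + s * r"
    by (simp add: algebra_simps)
  then show ?thesis by (simp add: le_iff_add)
qed

lemma mult_nonneg_same_sign:
  fixes \<delta> c w :: real
  assumes "0 \<le> \<delta> * c" "0 < c * w"
  shows "0 \<le> \<delta> * w"
proof (cases "0 < c")
  case True
  with assms have "0 < w" "0 \<le> \<delta>" by (simp_all add: zero_less_mult_iff zero_le_mult_iff)
  then show ?thesis by simp
next
  case False
  with assms(2) have "c < 0" "w < 0" by (auto simp: zero_less_mult_iff)
  with assms(1) have "\<delta> \<le> 0" by (simp add: zero_le_mult_iff)
  with \<open>w < 0\<close> show ?thesis by (simp add: mult_nonpos_nonpos)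
qed

lemma gauss_mono_norm:
  fixes x y :: "'a::euclidean_space"
  assumes "0 < z" "norm x \<le> norm y"
  shows "gauss z y \<le> gauss z x"
  using assms unfolding gauss_def
  by (intro mult_left_mono) (auto intro!: divide_right_mono power_mono)

text \<open>Reflect in the hyperplane half-way between the two centres. The reflection exchanges the two
  Gaussian kernels, and the half-space that contains the origin is at once the one where the kernel
  of the nearer centre is larger and the one where the radial function is larger, so the
  rearrangement inequality applies pointwise. Only reflections along basis vectors are needed,
  because the centre can be moved one coordinate at a time; the sign condition says that the
  coordinate moves away from \<open>0\<close>.\<close>

lemma nn_integral_gauss_shift_coordinate:
  fixes \<mu> b :: "'a::euclidean_space" and k :: "real \<Rightarrow> ennreal"
  assumes z: "0 < z" and [measurable]: "k \<in> borel_measurable borel"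
    and k: "antimono_on {0<..} k"
    and b: "b \<in> Basis" and sgn: "0 \<le> \<delta> * (\<mu> \<bullet> b + \<delta> / 2)"
  shows "(\<integral>\<^sup>+x. k ((norm x)\<^sup>2) * ennreal (gauss z (x - (\<mu> + \<delta> *\<^sub>R b))) \<partial>lborel)
       \<le> (\<integral>\<^sup>+x. k ((norm x)\<^sup>2) * ennreal (gauss z (x - \<mu>)) \<partial>lborel)"
proof -
  define c where "c = \<mu> \<bullet> b + \<delta> / 2"
  define \<rho> where "\<rho> x = x + (2 * (c - x \<bullet> b)) *\<^sub>R b" for x
  define \<nu> where "\<nu> = \<mu> + \<delta> *\<^sub>R b"
  have bb: "b \<bullet> b = 1" using b by simp
  have [measurable]: "\<rho> \<in> borel_measurable borel" unfolding \<rho>_def by measurable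
  have inv: "(\<integral>\<^sup>+x. f (\<rho> x) \<partial>lborel) = (\<integral>\<^sup>+x. f x \<partial>lborel)"
    if "f \<in> borel_measurable borel" for f :: "'a \<Rightarrow> ennreal"
    unfolding \<rho>_def using that b by (rule nn_integral_reflect)
  have rho_sq: "(norm (\<rho> x))\<^sup>2 = (norm x)\<^sup>2 + 4 * (c * (c - x \<bullet> b))" for x
    unfolding power2_norm_eq_inner \<rho>_def
    by (simp add: inner_add_left inner_add_right inner_commute[of b x] bb) (simp add: algebra_simps)
  have nu_sq: "(norm (x - \<nu>))\<^sup>2 = (norm (x - \<mu>))\<^sup>2 + 2 * (\<delta> * (c - x \<bullet> b))" for x
  proof -
    have "x - \<nu> = (x - \<mu>) - \<delta> *\<^sub>R b" by (simp add: \<nu>_def algebra_simps)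
    then have "(norm (x - \<nu>))\<^sup>2 = (norm (x - \<mu>))\<^sup>2 - 2 * (\<delta> * ((x - \<mu>) \<bullet> b)) + \<delta>\<^sup>2"
      unfolding power2_norm_eq_inner
      by (simp only: inner_diff_left[of "x - \<mu>"] inner_diff_right[of _ "x - \<mu>"] inner_scaleR_left
          inner_scaleR_right inner_commute[of b "x - \<mu>"] bb) (simp add: power2_eq_square algebra_simps)
    then show ?thesis by (simp add: c_def inner_diff_left power2_eq_square algebra_simps)
  qed
  have iso: "norm (\<rho> x - \<rho> y) = norm (x - y)" for x y
  proof -
    have "\<rho> x - \<rho> y = (x - y) - (2 * ((x - y) \<bullet> b)) *\<^sub>R b"
      by (simp add: \<rho>_def inner_diff_left algebra_simps)
    then have "(norm (\<rho> x - \<rho> y))\<^sup>2 = (norm (x - y))\<^sup>2"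
      unfolding power2_norm_eq_inner
      by (simp add: inner_diff_left[of "x - y"] inner_diff_right[of _ "x - y"] inner_commute[of b "x - y"] bb)
    then show ?thesis by simp
  qed
  have "\<rho> \<mu> = \<nu>" by (simp add: \<rho>_def \<nu>_def c_def)
  moreover have "\<rho> \<nu> = \<mu>" by (simp add: \<rho>_def \<nu>_def c_def inner_add_left bb algebra_simps)
  ultimately have swap: "gauss z (\<rho> x - \<nu>) = gauss z (x - \<mu>)" "gauss z (\<rho> x - \<mu>) = gauss z (x - \<nu>)" for x
    using iso[of x \<mu>] iso[of x \<nu>] by (simp_all add: gauss_def)
  let ?k = "\<lambda>x. k ((norm x)\<^sup>2)" and ?p = "\<lambda>x. ennreal (gauss z (x - \<mu>))"
    and ?p' = "\<lambda>x. ennreal (gauss z (x - \<nu>))"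
  have pw: "?k x * ?p' x + ?k (\<rho> x) * ?p x \<le> ?k x * ?p x + ?k (\<rho> x) * ?p' x"
    if "x \<noteq> 0" "\<rho> x \<noteq> 0" for x
  proof (cases "c * (c - x \<bullet> b)" "0::real" rule: linorder_cases)
    case greater
    then have "(norm x)\<^sup>2 \<le> (norm (\<rho> x))\<^sup>2"
      unfolding rho_sq by simp
    with k have k_le: "?k (\<rho> x) \<le> ?k x"
      using that by (simp add: monotone_on_def)
    have "0 \<le> \<delta> * (c - x \<bullet> b)"
      using sgn greater unfolding c_def[symmetric] by (rule mult_nonneg_same_sign)
    then have "(norm (x - \<mu>))\<^sup>2 \<le> (norm (x - \<nu>))\<^sup>2"
      unfolding nu_sq by simp
    then have "norm (x - \<mu>) \<le> norm (x - \<nu>)" by (rule power2_le_imp_le) simp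
    then have "?p' x \<le> ?p x" by (intro ennreal_leI gauss_mono_norm[OF z])
    with k_le show ?thesis by (rule ennreal_rearrangement)
  next
    case equal
    then have "(norm (\<rho> x))\<^sup>2 = (norm x)\<^sup>2" unfolding rho_sq by simp
    then have "?k (\<rho> x) = ?k x" by (rule arg_cong)
    then show ?thesis by (metis add.commute order_refl)
  next
    case less
    then have "(norm (\<rho> x))\<^sup>2 \<le> (norm x)\<^sup>2"
      unfolding rho_sq by simp
    with k have k_le: "?k x \<le> ?k (\<rho> x)"
      using that by (simp add: monotone_on_def)
    have neg: "\<delta> * (c - x \<bullet> b) = - (\<delta> * - (c - x \<bullet> b))"
      by (simp only: mult_minus_right minus_minus)
    have "0 < c * - (c - x \<bullet> b)" using less by (simp only: mult_minus_right neg_0_less_iff_less)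
    with sgn have "0 \<le> \<delta> * - (c - x \<bullet> b)"
      unfolding c_def[symmetric] by (rule mult_nonneg_same_sign)
    then have "(norm (x - \<nu>))\<^sup>2 \<le> (norm (x - \<mu>))\<^sup>2"
      unfolding nu_sq neg by linarith
    then have "norm (x - \<nu>) \<le> norm (x - \<mu>)" by (rule power2_le_imp_le) simp
    then have "?p x \<le> ?p' x" by (intro ennreal_leI gauss_mono_norm[OF z])
    from ennreal_rearrangement[OF k_le this] show ?thesis by (metis add.commute)
  qed
  have \<rho>\<rho>: "\<rho> (\<rho> x) = x" for x
  proof -
    have "\<rho> x \<bullet> b = 2 * c - x \<bullet> b"
      unfolding \<rho>_def by (simp add: inner_add_left bb)
    then have "\<rho> (\<rho> x) = \<rho> x - (2 * (c - x \<bullet> b)) *\<^sub>R b"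
      unfolding \<rho>_def[of "\<rho> x"] by (simp flip: scaleR_minus_left)
    then show ?thesis by (simp add: \<rho>_def)
  qed
  have ae: "AE x in lborel. x \<noteq> 0 \<and> \<rho> x \<noteq> 0"
    using AE_lborel_singleton[of 0] AE_lborel_singleton[of "\<rho> 0"]
  proof eventually_elim
    case (elim x)
    then show ?case using \<rho>\<rho>[of x] by metis
  qed
  \<comment> \<open>Averaging each integral with its reflected copy pairs every point with its mirror image.\<close>
  have "2 * (\<integral>\<^sup>+x. ?k x * ?p' x \<partial>lborel)
      = (\<integral>\<^sup>+x. ?k x * ?p' x \<partial>lborel) + (\<integral>\<^sup>+x. ?k (\<rho> x) * ?p' (\<rho> x) \<partial>lborel)"
    using inv[of "\<lambda>x. ?k x * ?p' x"] by (simp only: mult_2) simp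
  also have "\<dots> = (\<integral>\<^sup>+x. ?k x * ?p' x + ?k (\<rho> x) * ?p x \<partial>lborel)"
    unfolding swap by (rule nn_integral_add[symmetric]) measurable
  also have "\<dots> \<le> (\<integral>\<^sup>+x. ?k x * ?p x + ?k (\<rho> x) * ?p' x \<partial>lborel)"
  proof (rule nn_integral_mono_AE)
    show "AE x in lborel. ?k x * ?p' x + ?k (\<rho> x) * ?p x \<le> ?k x * ?p x + ?k (\<rho> x) * ?p' x"
      using ae by eventually_elim (rule pw, blast+)
  qed
  also have "\<dots> = (\<integral>\<^sup>+x. ?k x * ?p x \<partial>lborel) + (\<integral>\<^sup>+x. ?k (\<rho> x) * ?p (\<rho> x) \<partial>lborel)"
    unfolding swap by (rule nn_integral_add) measurable
  also have "\<dots> = 2 * (\<integral>\<^sup>+x. ?k x * ?p x \<partial>lborel)"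
    using inv[of "\<lambda>x. ?k x * ?p x"] by (simp only: mult_2) simp
  finally show ?thesis
    unfolding \<nu>_def by (simp add: ennreal_mult_le_mult_iff)
qed

lemma nn_integral_gauss_shift:
  fixes \<mu> :: "'a::euclidean_space" and k :: "real \<Rightarrow> ennreal"
  assumes z: "0 < z" and k: "k \<in> borel_measurable borel" "antimono_on {0<..} k"
    and s: "0 \<le> s" "s \<le> 1"
  shows "(\<integral>\<^sup>+x. k ((norm x)\<^sup>2) * ennreal (gauss z (x - \<mu>)) \<partial>lborel)
       \<le> (\<integral>\<^sup>+x. k ((norm x)\<^sup>2) * ennreal (gauss z (x - s *\<^sub>R \<mu>)) \<partial>lborel)"
proof -
  let ?I = "\<lambda>\<nu>. \<integral>\<^sup>+x. k ((norm x)\<^sup>2) * ennreal (gauss z (x - \<nu>)) \<partial>lborel"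
  \<comment> \<open>The centre in which the coordinates in \<open>A\<close> have been moved and the others not.\<close>
  define part where "part A = s *\<^sub>R \<mu> + (\<Sum>b\<in>A. ((1 - s) * (\<mu> \<bullet> b)) *\<^sub>R b)" for A
  have "finite A \<Longrightarrow> A \<subseteq> Basis \<Longrightarrow> ?I (part A) \<le> ?I (s *\<^sub>R \<mu>)" for A
  proof (induction A rule: finite_induct)
    case empty
    then show ?case by (simp add: part_def)
  next
    case (insert b A)
    let ?d = "(1 - s) * (\<mu> \<bullet> b)"
    have "part A \<bullet> b = s * (\<mu> \<bullet> b) + (\<Sum>j\<in>A. ((1 - s) * (\<mu> \<bullet> j)) * (j \<bullet> b))"
      by (simp add: part_def inner_add_left inner_sum_left)
    also have "(\<Sum>j\<in>A. ((1 - s) * (\<mu> \<bullet> j)) * (j \<bullet> b)) = 0"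
    proof (intro sum.neutral ballI)
      fix j assume "j \<in> A"
      then have "j \<bullet> b = 0" using insert by (intro inner_not_same_Basis) auto
      then show "((1 - s) * (\<mu> \<bullet> j)) * (j \<bullet> b) = 0" by simp
    qed
    finally have eq: "?d * (part A \<bullet> b + ?d / 2) = (1 - s) * (1 + s) / 2 * (\<mu> \<bullet> b)\<^sup>2"
      by (simp add: power2_eq_square field_simps)
    have "0 \<le> ?d * (part A \<bullet> b + ?d / 2)"
      unfolding eq using s by (intro mult_nonneg_nonneg divide_nonneg_nonneg) auto
    moreover have "part (insert b A) = part A + ?d *\<^sub>R b"
      using insert by (simp add: part_def algebra_simps)
    ultimately have "?I (part (insert b A)) \<le> ?I (part A)"
      using nn_integral_gauss_shift_coordinate[OF z k, of b ?d "part A"] insert by simp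
    then show ?case using insert by auto
  qed
  from this[of Basis] have "?I (part Basis) \<le> ?I (s *\<^sub>R \<mu>)" by simp
  also have "part Basis = \<mu>"
  proof -
    have "part Basis = s *\<^sub>R \<mu> + (1 - s) *\<^sub>R (\<Sum>b\<in>Basis. (\<mu> \<bullet> b) *\<^sub>R b)"
      by (simp add: part_def scaleR_sum_right)
    then show ?thesis by (simp add: euclidean_representation scaleR_diff_left)
  qed
  finally show ?thesis .
qed

lemma gauss_scale:
  fixes y :: "'a::euclidean_space"
  assumes z: "0 < z"
  shows "sqrt z ^ DIM('a) * gauss z (sqrt z *\<^sub>R y) = gauss 1 y"
proof -
  have "sqrt z ^ DIM('a) = z powr (real DIM('a) / 2)"
  proof -
    have "sqrt z ^ DIM('a) = (z powr (1 / 2)) powr real DIM('a)"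
      using z by (subst powr_realpow) (auto simp: powr_half_sqrt)
    then show ?thesis by (simp add: powr_powr)
  qed
  then have "sqrt z ^ DIM('a) * z powr (- (real DIM('a) / 2)) = 1"
    using z by (simp flip: powr_add)
  then show ?thesis
    using z by (simp add: gauss_def powr_mult power_mult_distrib mult.left_commute)
qed

lemma nn_integral_gauss_standardize:
  fixes \<mu> :: "'a::euclidean_space"
  assumes z: "0 < z" and [measurable]: "f \<in> borel_measurable borel"
  shows "(\<integral>\<^sup>+x. f x * ennreal (gauss z (x - \<mu>)) \<partial>lborel)
       = (\<integral>\<^sup>+y. f (sqrt z *\<^sub>R y) * ennreal (gauss 1 (y - (1 / sqrt z) *\<^sub>R \<mu>)) \<partial>lborel)"
proof -
  have "(\<integral>\<^sup>+x. f x * ennreal (gauss z (x - \<mu>)) \<partial>lborel)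
     = ennreal (sqrt z ^ DIM('a)) * (\<integral>\<^sup>+y. f (sqrt z *\<^sub>R y) * ennreal (gauss z (sqrt z *\<^sub>R y - \<mu>)) \<partial>lborel)"
    using z nn_integral_lborel_affine[of "\<lambda>x. f x * ennreal (gauss z (x - \<mu>))" "sqrt z" 0] by simp
  also have "\<dots> = (\<integral>\<^sup>+y. ennreal (sqrt z ^ DIM('a)) * (f (sqrt z *\<^sub>R y) * ennreal (gauss z (sqrt z *\<^sub>R y - \<mu>))) \<partial>lborel)"
    by (simp add: nn_integral_cmult)
  also have "\<dots> = (\<integral>\<^sup>+y. f (sqrt z *\<^sub>R y) * ennreal (gauss 1 (y - (1 / sqrt z) *\<^sub>R \<mu>)) \<partial>lborel)"
  proof (intro nn_integral_cong)
    fix y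
    have "sqrt z *\<^sub>R y - \<mu> = sqrt z *\<^sub>R (y - (1 / sqrt z) *\<^sub>R \<mu>)"
      using z by (simp add: scaleR_diff_right)
    then show "ennreal (sqrt z ^ DIM('a)) * (f (sqrt z *\<^sub>R y) * ennreal (gauss z (sqrt z *\<^sub>R y - \<mu>)))
       = f (sqrt z *\<^sub>R y) * ennreal (gauss 1 (y - (1 / sqrt z) *\<^sub>R \<mu>))"
      using z by (simp add: gauss_scale[OF z, symmetric] ennreal_mult mult.left_commute)
  qed
  finally show ?thesis .
qed

section \<open>Moments of isotropic Gaussian densities\<close>
text \<open>Moving the centre to the origin only increases the integral. There
  \<open>1 / (norm x)\<^sup>2 = \<integral>\<^sub>0\<^sup>\<infinity> exp (- s * (norm x)\<^sup>2) ds\<close> and Tonelli reduce it to the integral of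
  \<open>(1 + 2 * s) powr (- p / 2)\<close>, which converges for \<open>p \<ge> 3\<close>. This is where the dimension restriction
  enters.\<close>

lemma nn_integral_gauss_inverse_square:
  fixes \<mu> :: "'a::euclidean_space"
  assumes z: "0 < z" and d: "3 \<le> DIM('a)"
  shows "(\<integral>\<^sup>+x. ennreal (1 / (norm x)\<^sup>2) * ennreal (gauss z (x - \<mu>)) \<partial>lborel) < \<infinity>"
proof -
  have laplace: "(\<integral>\<^sup>+s. ennreal (exp (- (s * c))) * indicator {0..} s \<partial>lborel) = ennreal (1 / c)"
    if "0 < c" for c :: real
  proof -
    have lim: "((\<lambda>s. - exp (- (s * c)) / c) \<longlongrightarrow> 0) at_top"
      using that by real_asymp
    have "(\<integral>\<^sup>+s. ennreal (exp (- (s * c))) * indicator {0..} s \<partial>lborel)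
        = ennreal (0 - (- exp (- (0 * c)) / c))"
    proof (rule nn_integral_FTC_atLeast[OF _ _ _ lim])
      show "DERIV (\<lambda>s. - exp (- (s * c)) / c) s :> exp (- (s * c))" for s
        using that by (auto intro!: derivative_eq_intros)
    qed simp_all
    then show ?thesis by simp
  qed
  have tail: "(\<integral>\<^sup>+s. ennreal ((1 + 2 * s) powr (- (3 / 2))) * indicator {0..} s \<partial>lborel) = ennreal 1"
  proof -
    have lim: "((\<lambda>s::real. - ((1 + 2 * s) powr (- (1 / 2)))) \<longlongrightarrow> 0) at_top"
      by real_asymp
    have "(\<integral>\<^sup>+s. ennreal ((1 + 2 * s) powr (- (3 / 2))) * indicator {0..} s \<partial>lborel)
        = ennreal (0 - (- ((1 + 2 * 0) powr (- (1 / 2)))))"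
    proof (rule nn_integral_FTC_atLeast[OF _ _ _ lim])
      fix s :: real assume s: "0 \<le> s"
      have lin: "DERIV (\<lambda>s. 1 + 2 * s) s :> 2"
        by (auto intro!: derivative_eq_intros)
      have "DERIV (\<lambda>s. (1 + 2 * s) powr (- (1 / 2))) s :> - (1 / 2) * (1 + 2 * s) powr (- (1 / 2) - of_nat 1) * 2"
        using s by (intro DERIV_fun_powr[OF lin]) auto
      then have "DERIV (\<lambda>s. - ((1 + 2 * s) powr (- (1 / 2)))) s :> - (- (1 / 2) * (1 + 2 * s) powr (- (1 / 2) - of_nat 1) * 2)"
        by (rule DERIV_minus)
      then show "DERIV (\<lambda>s. - ((1 + 2 * s) powr (- (1 / 2)))) s :> (1 + 2 * s) powr (- (3 / 2))"
        by simp
    qed simp_all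
    then show ?thesis by simp
  qed
  have tilt: "exp (- (s * (norm y)\<^sup>2)) * gauss 1 y
      = (1 + 2 * s) powr (- (real DIM('a) / 2)) * gauss (1 / (1 + 2 * s)) y" if "0 \<le> s" for s and y :: 'a
  proof -
    have s1: "0 < 1 + 2 * s" using that by simp
    have e: "- (s * (norm y)\<^sup>2) + - (norm y)\<^sup>2 / (2 * 1) = - (norm y)\<^sup>2 / (2 * (1 / (1 + 2 * s)))"
      using s1 by (simp add: field_simps)
    have p: "(1 + 2 * s) powr (- (real DIM('a) / 2)) * (2 * pi * (1 / (1 + 2 * s))) powr (- (real DIM('a) / 2))
        = (2 * pi * 1) powr (- (real DIM('a) / 2))"
      using s1 by (simp flip: powr_mult)
    show ?thesis
    proof -
      have "exp (- (s * (norm y)\<^sup>2)) * exp (- (norm y)\<^sup>2 / (2 * 1))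
          = exp (- (norm y)\<^sup>2 / (2 * (1 / (1 + 2 * s))))"
        by (simp only: e flip: exp_add)
      from arg_cong2[OF p[symmetric] this, of "(*)"] show ?thesis
        unfolding gauss_def by (simp only: mult_ac)
    qed
  qed
  have anti: "antimono_on {0<..} (\<lambda>t. ennreal (1 / t))"
    by (auto intro!: monotone_onI ennreal_leI divide_left_mono)
  have "(\<integral>\<^sup>+x. ennreal (1 / (norm x)\<^sup>2) * ennreal (gauss z (x - \<mu>)) \<partial>lborel)
     \<le> (\<integral>\<^sup>+x. ennreal (1 / (norm x)\<^sup>2) * ennreal (gauss z (x - 0 *\<^sub>R \<mu>)) \<partial>lborel)"
    using nn_integral_gauss_shift[OF z _ anti, of 0 \<mu>] by simp
  also have "\<dots> = (\<integral>\<^sup>+y. ennreal (1 / (norm (sqrt z *\<^sub>R y))\<^sup>2) * ennreal (gauss 1 (y - (1 / sqrt z) *\<^sub>R (0::'a))) \<partial>lborel)"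
    by (subst nn_integral_gauss_standardize[OF z]) simp_all
  also have "\<dots> = (\<integral>\<^sup>+y. ennreal (1 / z) * (ennreal (1 / (norm y)\<^sup>2) * ennreal (gauss 1 (y::'a))) \<partial>lborel)"
    using z by (intro nn_integral_cong) (simp add: power_mult_distrib ennreal_mult mult.assoc flip: ennreal_mult)
  also have "\<dots> = ennreal (1 / z) * (\<integral>\<^sup>+y. ennreal (1 / (norm y)\<^sup>2) * ennreal (gauss 1 (y::'a)) \<partial>lborel)"
    by (rule nn_integral_cmult) measurable
  also have "(\<integral>\<^sup>+y. ennreal (1 / (norm y)\<^sup>2) * ennreal (gauss 1 (y::'a)) \<partial>lborel)
     = (\<integral>\<^sup>+y. \<integral>\<^sup>+s. ennreal (exp (- (s * (norm y)\<^sup>2))) * indicator {0..} s * ennreal (gauss 1 (y::'a)) \<partial>lborel \<partial>lborel)"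
  proof (rule nn_integral_cong_AE)
    show "AE y in lborel. ennreal (1 / (norm y)\<^sup>2) * ennreal (gauss 1 (y::'a))
      = (\<integral>\<^sup>+s. ennreal (exp (- (s * (norm y)\<^sup>2))) * indicator {0..} s * ennreal (gauss 1 (y::'a)) \<partial>lborel)"
      using AE_lborel_singleton[of "0::'a"]
      by eventually_elim (subst nn_integral_multc, measurable, simp add: laplace)
  qed
  also have "\<dots> = (\<integral>\<^sup>+s. \<integral>\<^sup>+y. ennreal (exp (- (s * (norm y)\<^sup>2))) * indicator {0..} s * ennreal (gauss 1 (y::'a)) \<partial>lborel \<partial>lborel)"
    by (rule nn_integral_swap) (unfold_locales, measurable)
  also have "\<dots> \<le> (\<integral>\<^sup>+s. ennreal ((1 + 2 * s) powr (- (3 / 2))) * indicator {0..} s \<partial>lborel)"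
  proof (rule nn_integral_mono)
    fix s :: real
    show "(\<integral>\<^sup>+y. ennreal (exp (- (s * (norm y)\<^sup>2))) * indicator {0..} s * ennreal (gauss 1 (y::'a)) \<partial>lborel)
       \<le> ennreal ((1 + 2 * s) powr (- (3 / 2))) * indicator {0..} s"
    proof (cases "0 \<le> s")
      case True
      then have "(\<integral>\<^sup>+y. ennreal (exp (- (s * (norm y)\<^sup>2))) * indicator {0..} s * ennreal (gauss 1 (y::'a)) \<partial>lborel)
        = (\<integral>\<^sup>+y. ennreal ((1 + 2 * s) powr (- (real DIM('a) / 2))) * ennreal (gauss (1 / (1 + 2 * s)) (y - (0::'a))) \<partial>lborel)"
        by (simp add: tilt flip: ennreal_mult)
      also have "\<dots> = ennreal ((1 + 2 * s) powr (- (real DIM('a) / 2)))"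
        using True nn_integral_gauss[of "1 / (1 + 2 * s)" "0::'a"]
        by (subst nn_integral_cmult) simp_all
      also have "\<dots> \<le> ennreal ((1 + 2 * s) powr (- (3 / 2)))"
        using True d by (intro ennreal_leI powr_mono) auto
      finally show ?thesis using True by simp
    qed simp
  qed
  also note tail
  finally have "(\<integral>\<^sup>+x. ennreal (1 / (norm x)\<^sup>2) * ennreal (gauss z (x - \<mu>)) \<partial>lborel) \<le> ennreal (1 / z) * ennreal 1"
    by (simp add: mult_left_mono)
  also have "\<dots> < \<infinity>" by simp
  finally show ?thesis .
qed

text \<open>By scaling the second moment is linear in \<open>z\<close>, and it is finite because \<open>u * exp (- u) \<le> 1\<close> dominates
  the integrand by a multiple of the kernel of variance \<open>2\<close>. The constant is the dimension.\<close>

lemma gauss_dispersion: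
  "\<exists>M\<ge>0. \<forall>z>0. \<forall>\<mu>::'a::euclidean_space.
     (\<integral>\<^sup>+x. ennreal ((norm (x - \<mu>))\<^sup>2) * ennreal (gauss z (x - \<mu>)) \<partial>lborel) = ennreal (z * M)"
proof -
  let ?M = "\<integral>\<^sup>+y. ennreal ((norm y)\<^sup>2) * ennreal (gauss 1 (y::'a)) \<partial>lborel"
  have bound: "(norm y)\<^sup>2 * gauss 1 y \<le> 4 * 2 powr (real DIM('a) / 2) * gauss 2 y" for y :: 'a
  proof -
    define u where "u = (norm y)\<^sup>2 / 4"
    have "u \<le> exp u" using exp_ge_add_one_self[of u] by linarith
    then have "u * exp (- u) \<le> 1"
      using mult_right_mono[of u "exp u" "exp (- u)"] by (simp flip: exp_add)
    then have "u * exp (- u) * exp (- u) \<le> 1 * exp (- u)" by (rule mult_right_mono) simp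
    moreover have "exp (- (norm y)\<^sup>2 / (2 * 1)) = exp (- u) * exp (- u)" "(norm y)\<^sup>2 = 4 * u"
      "exp (- (norm y)\<^sup>2 / (2 * 2)) = exp (- u)"
      by (simp_all add: u_def flip: exp_add)
    ultimately have "(norm y)\<^sup>2 * exp (- (norm y)\<^sup>2 / (2 * 1)) \<le> 4 * exp (- (norm y)\<^sup>2 / (2 * 2))"
      by (simp only: mult.assoc)
    then have "(2 * pi) powr (- (real DIM('a) / 2)) * ((norm y)\<^sup>2 * exp (- (norm y)\<^sup>2 / (2 * 1)))
        \<le> (2 * pi) powr (- (real DIM('a) / 2)) * (4 * exp (- (norm y)\<^sup>2 / (2 * 2)))"
      by (rule mult_left_mono) simp
    moreover have "(2 * pi * 2) powr (- (real DIM('a) / 2)) * 2 powr (real DIM('a) / 2)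
        = (2 * pi) powr (- (real DIM('a) / 2))"
    proof -
      have "(2 * pi * 2) powr (- (real DIM('a) / 2))
          = (2 * pi) powr (- (real DIM('a) / 2)) * 2 powr (- (real DIM('a) / 2))"
        by (rule powr_mult)
      then show ?thesis by (simp add: mult.assoc flip: powr_add)
    qed
    ultimately show ?thesis unfolding gauss_def by (simp add: mult_ac)
  qed
  have "?M \<le> (\<integral>\<^sup>+y. ennreal (4 * 2 powr (real DIM('a) / 2)) * ennreal (gauss 2 (y - (0::'a))) \<partial>lborel)"
    by (intro nn_integral_mono) (simp add: bound ennreal_leI flip: ennreal_mult)
  also have "\<dots> = ennreal (4 * 2 powr (real DIM('a) / 2))"
    using nn_integral_gauss[of 2 "0::'a"] by (subst nn_integral_cmult) simp_all
  finally have "?M < \<infinity>" by (rule le_less_trans) simp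
  then have M: "?M = ennreal (enn2real ?M)" by simp
  have "(\<integral>\<^sup>+x. ennreal ((norm (x - \<mu>))\<^sup>2) * ennreal (gauss z (x - \<mu>)) \<partial>lborel) = ennreal (z * enn2real ?M)"
    if z: "0 < z" for z and \<mu> :: 'a
  proof -
    have "(\<integral>\<^sup>+x. ennreal ((norm (x - \<mu>))\<^sup>2) * ennreal (gauss z (x - \<mu>)) \<partial>lborel)
        = (\<integral>\<^sup>+x. ennreal ((norm x)\<^sup>2) * ennreal (gauss z (x - (0::'a))) \<partial>lborel)"
      using nn_integral_lborel_translate[of "\<lambda>x. ennreal ((norm x)\<^sup>2) * ennreal (gauss z x)" \<mu>] by simp
    also have "\<dots> = (\<integral>\<^sup>+y. ennreal ((norm (sqrt z *\<^sub>R y))\<^sup>2) * ennreal (gauss 1 (y - (1 / sqrt z) *\<^sub>R (0::'a))) \<partial>lborel)"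
      by (rule nn_integral_gauss_standardize[OF z]) simp
    also have "\<dots> = (\<integral>\<^sup>+y. ennreal z * (ennreal ((norm y)\<^sup>2) * ennreal (gauss 1 (y::'a))) \<partial>lborel)"
      using z by (intro nn_integral_cong) (simp add: power_mult_distrib mult.assoc flip: ennreal_mult)
    also have "\<dots> = ennreal z * ?M" by (rule nn_integral_cmult) measurable
    also have "\<dots> = ennreal (z * enn2real ?M)" using z by (subst M) (simp add: ennreal_mult)
    finally show ?thesis .
  qed
  then show ?thesis by (intro exI[of _ "enn2real ?M"]) auto
qed

section \<open>Shrinkage under a normal law\<close>
text \<open>The factor \<open>h t = r t / t\<close> of a Baranchik estimator, extended to \<open>t = 0\<close>. The assumptions
  on \<open>r\<close> say that \<open>h\<close> and \<open>t * h t\<close> are monotone in opposite directions; they do the work of a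
  derivative of \<open>r\<close> below.\<close>

locale shrinkage =
  fixes h :: "real \<Rightarrow> real" and space_type :: "'a::euclidean_space itself"
  assumes h_measurable [measurable]: "h \<in> borel_measurable borel"
    and h_nonneg [simp]: "0 \<le> h t"
    and h_antimono: "0 < s \<Longrightarrow> s \<le> t \<Longrightarrow> h t \<le> h s"
    and r_mono: "0 < s \<Longrightarrow> s \<le> t \<Longrightarrow> s * h s \<le> t * h t"
    and r_le_1: "0 \<le> t \<Longrightarrow> t * h t \<le> 1"
    and dim: "3 \<le> DIM('a)"
begin

abbreviation \<eta> :: "'a \<Rightarrow> real" where "\<eta> x \<equiv> h ((norm x)\<^sup>2)"

definition \<psi> :: "real \<Rightarrow> 'a \<Rightarrow> real" where
  "\<psi> z \<mu> = (\<integral>x. \<eta> x * gauss z (x - \<mu>) \<partial>lborel)"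

lemma r_norm_le_1: "(norm x)\<^sup>2 * \<eta> (x::'a) \<le> 1"
  by (rule r_le_1) simp

lemma psi:
  assumes z: "0 < z"
  shows "integrable lborel (\<lambda>x. \<eta> x * gauss z (x - \<mu>))"
    and "(\<integral>\<^sup>+x. ennreal (\<eta> x) * ennreal (gauss z (x - \<mu>)) \<partial>lborel) = ennreal (\<psi> z \<mu>)"
    and "0 \<le> \<psi> z \<mu>"
proof -
  have "(\<integral>\<^sup>+x. ennreal (\<eta> x * gauss z (x - \<mu>)) \<partial>lborel)
      \<le> (\<integral>\<^sup>+x. ennreal (1 / (norm x)\<^sup>2) * ennreal (gauss z (x - \<mu>)) \<partial>lborel)"
  proof (rule nn_integral_mono_AE)
    show "AE x in lborel. ennreal (\<eta> x * gauss z (x - \<mu>)) \<le> ennreal (1 / (norm x)\<^sup>2) * ennreal (gauss z (x - \<mu>))"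
      using AE_lborel_singleton[of "0::'a"]
    proof eventually_elim
      case (elim x)
      then have "\<eta> x \<le> 1 / (norm x)\<^sup>2"
        using r_norm_le_1[of x] by (simp add: field_simps)
      then have "\<eta> x * gauss z (x - \<mu>) \<le> 1 / (norm x)\<^sup>2 * gauss z (x - \<mu>)"
        by (rule mult_right_mono) simp
      then show ?case by (simp add: ennreal_leI flip: ennreal_mult)
    qed
  qed
  also have "\<dots> < \<infinity>" by (rule nn_integral_gauss_inverse_square[OF z dim])
  finally show int: "integrable lborel (\<lambda>x. \<eta> x * gauss z (x - \<mu>))"
    by (intro integrableI_nonneg) auto
  show "(\<integral>\<^sup>+x. ennreal (\<eta> x) * ennreal (gauss z (x - \<mu>)) \<partial>lborel) = ennreal (\<psi> z \<mu>)"
    unfolding \<psi>_def using nn_integral_eq_integral[OF int] by (simp add: ennreal_mult)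
  show "0 \<le> \<psi> z \<mu>" by (simp add: \<psi>_def)
qed

text \<open>In standardised coordinates the left-hand side is the mean of \<open>z * h (z * (norm Y)\<^sup>2)\<close>, where \<open>Y\<close>
  is standard normal about \<open>\<mu> / sqrt z\<close>. Increasing \<open>z\<close> increases the integrand for fixed \<open>Y\<close>,
  because \<open>t * h t\<close> increases, and moves the centre of \<open>Y\<close> towards the origin, which helps because
  \<open>h\<close> decreases.\<close>

lemma psi_scaled_mono:
  fixes \<mu> :: 'a
  assumes z: "0 < z" "z \<le> z'"
  shows "z * \<psi> z \<mu> \<le> z' * \<psi> z' \<mu>"
proof -
  have z': "0 < z'" using z by simp
  have std: "ennreal (v * \<psi> v \<mu>)
      = (\<integral>\<^sup>+y. ennreal (v * h (v * (norm y)\<^sup>2)) * ennreal (gauss 1 (y - (1 / sqrt v) *\<^sub>R \<mu>)) \<partial>lborel)"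
    if v: "0 < v" for v
  proof -
    have "ennreal (v * \<psi> v \<mu>) = ennreal v * (\<integral>\<^sup>+x. ennreal (\<eta> x) * ennreal (gauss v (x - \<mu>)) \<partial>lborel)"
      using v by (simp add: psi ennreal_mult)
    also have "(\<integral>\<^sup>+x. ennreal (\<eta> x) * ennreal (gauss v (x - \<mu>)) \<partial>lborel)
      = (\<integral>\<^sup>+y. ennreal (h (v * (norm y)\<^sup>2)) * ennreal (gauss 1 (y - (1 / sqrt v) *\<^sub>R \<mu>)) \<partial>lborel)"
      using v by (subst nn_integral_gauss_standardize[OF v]) (simp_all add: power_mult_distrib)
    finally show ?thesis using v
      by (simp add: ennreal_mult mult.assoc nn_integral_cmult)
  qed
  have anti: "antimono_on {0<..} (\<lambda>t. ennreal (z' * h (z' * t)))"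
    using z' by (auto intro!: monotone_onI ennreal_leI mult_left_mono h_antimono)
  \<comment> \<open>Passing from \<open>z\<close> to \<open>z'\<close> contracts the standardised centre by a factor at most \<open>1\<close>.\<close>
  have shift: "(sqrt z / sqrt z') *\<^sub>R (1 / sqrt z) *\<^sub>R \<mu> = (1 / sqrt z') *\<^sub>R \<mu>"
    using z by simp
  have "ennreal (z * \<psi> z \<mu>)
    = (\<integral>\<^sup>+y. ennreal (z * h (z * (norm y)\<^sup>2)) * ennreal (gauss 1 (y - (1 / sqrt z) *\<^sub>R \<mu>)) \<partial>lborel)"
    using z by (intro std)
  also have "\<dots> \<le> (\<integral>\<^sup>+y. ennreal (z' * h (z' * (norm y)\<^sup>2)) * ennreal (gauss 1 (y - (1 / sqrt z) *\<^sub>R \<mu>)) \<partial>lborel)"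
  proof (rule nn_integral_mono_AE)
    show "AE y in lborel. ennreal (z * h (z * (norm y)\<^sup>2)) * ennreal (gauss 1 (y - (1 / sqrt z) *\<^sub>R \<mu>))
        \<le> ennreal (z' * h (z' * (norm y)\<^sup>2)) * ennreal (gauss 1 (y - (1 / sqrt z) *\<^sub>R \<mu>))"
      using AE_lborel_singleton[of "0::'a"]
    proof eventually_elim
      case (elim y)
      then have "(z * (norm y)\<^sup>2) * h (z * (norm y)\<^sup>2) \<le> (z' * (norm y)\<^sup>2) * h (z' * (norm y)\<^sup>2)"
        using z by (intro r_mono) (auto intro: mult_right_mono)
      then have "(norm y)\<^sup>2 * (z * h (z * (norm y)\<^sup>2)) \<le> (norm y)\<^sup>2 * (z' * h (z' * (norm y)\<^sup>2))"
        by (simp only: mult_ac)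
      then have "z * h (z * (norm y)\<^sup>2) \<le> z' * h (z' * (norm y)\<^sup>2)"
        using elim by simp
      then show ?case by (intro mult_right_mono ennreal_leI) auto
    qed
  qed
  also have "\<dots> \<le> (\<integral>\<^sup>+y. ennreal (z' * h (z' * (norm y)\<^sup>2))
      * ennreal (gauss 1 (y - (sqrt z / sqrt z') *\<^sub>R (1 / sqrt z) *\<^sub>R \<mu>)) \<partial>lborel)"
    using z by (intro nn_integral_gauss_shift[OF _ _ anti]) auto
  also have "\<dots> = ennreal (z' * \<psi> z' \<mu>)"
    unfolding shift by (rule std[OF z', symmetric])
  finally show ?thesis
    using z' psi(3)[OF z', of \<mu>] by (simp add: ennreal_le_iff)
qed

lemma stein_integrable:
  fixes \<mu> :: 'a
  assumes z: "0 < z"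
  shows "integrable lborel (\<lambda>x. (norm (x - \<mu>))\<^sup>2 * gauss z (x - \<mu>))" (is ?A)
    and "integrable lborel (\<lambda>x. \<eta> x * (x \<bullet> (x - \<mu>)) * gauss z (x - \<mu>))" (is ?B)
proof -
  obtain M where M: "0 \<le> M" "\<And>z (\<mu>::'a). 0 < z \<Longrightarrow>
     (\<integral>\<^sup>+x. ennreal ((norm (x - \<mu>))\<^sup>2) * ennreal (gauss z (x - \<mu>)) \<partial>lborel) = ennreal (z * M)"
    using gauss_dispersion[where 'a = 'a] by blast
  have "(\<integral>\<^sup>+x. ennreal ((norm (x - \<mu>))\<^sup>2 * gauss z (x - \<mu>)) \<partial>lborel) = ennreal (z * M)"
    using M(2)[OF z, of \<mu>] by (simp add: ennreal_mult)
  then show A: ?A by (intro integrableI_nonneg) auto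
  show ?B
  proof (rule Bochner_Integration.integrable_bound)
    show "integrable lborel (\<lambda>x. \<eta> x * gauss z (x - \<mu>) + (norm (x - \<mu>))\<^sup>2 * gauss z (x - \<mu>))"
      by (intro Bochner_Integration.integrable_add psi(1)[OF z] A)
    show "AE x in lborel. norm (\<eta> x * (x \<bullet> (x - \<mu>)) * gauss z (x - \<mu>))
      \<le> norm (\<eta> x * gauss z (x - \<mu>) + (norm (x - \<mu>))\<^sup>2 * gauss z (x - \<mu>))"
    proof (rule AE_I2)
      fix x :: 'a
      let ?p = "norm x" and ?d = "norm (x - \<mu>)"
      have "\<bar>\<eta> x * (x \<bullet> (x - \<mu>))\<bar> \<le> (\<eta> x * ?p) * ?d"
        using Cauchy_Schwarz_ineq2[of x "x - \<mu>"] by (simp add: abs_mult mult.assoc mult_left_mono)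
      also have "\<dots> \<le> (\<eta> x * ?p)\<^sup>2 + ?d\<^sup>2"
      proof -
        have "0 \<le> (\<eta> x * ?p) * ?d" by simp
        with sum_squares_bound[of "\<eta> x * ?p" ?d] show ?thesis by linarith
      qed
      also have "(\<eta> x * ?p)\<^sup>2 = \<eta> x * (?p\<^sup>2 * \<eta> x)"
        by (simp add: power2_eq_square)
      also have "\<eta> x * (?p\<^sup>2 * \<eta> x) \<le> \<eta> x"
        using r_norm_le_1[of x] by (intro mult_left_le) auto
      finally have "\<bar>\<eta> x * (x \<bullet> (x - \<mu>))\<bar> \<le> \<eta> x + ?d\<^sup>2" by simp
      then have "\<bar>\<eta> x * (x \<bullet> (x - \<mu>))\<bar> * gauss z (x - \<mu>) \<le> (\<eta> x + ?d\<^sup>2) * gauss z (x - \<mu>)"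
        by (rule mult_right_mono) simp
      then show "norm (\<eta> x * (x \<bullet> (x - \<mu>)) * gauss z (x - \<mu>))
          \<le> norm (\<eta> x * gauss z (x - \<mu>) + ?d\<^sup>2 * gauss z (x - \<mu>))"
        by (simp add: abs_mult distrib_right)
    qed
  qed measurable
qed

text \<open>A finite-difference form of Stein's identity. The integral of \<open>\<eta> x * gauss z (l x - \<mu>)\<close> is computed in
  two ways for \<open>l = 1 + \<epsilon>\<close>: by substitution it is at most \<open>l ^ (2 - p) * \<psi> z \<mu>\<close>, since \<open>t * h t\<close>
  increases, and by the tangent inequality it is at least \<open>\<psi> z \<mu>\<close> minus a first-order term in \<open>B\<close>
  and a second-order remainder. Thus monotonicity replaces the derivative of \<open>h\<close>.\<close>

lemma stein_dilation:
  fixes \<mu> :: 'a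
  assumes z: "0 < z" and \<epsilon>: "0 < \<epsilon>"
  defines "B \<equiv> (\<integral>x. \<eta> x * (x \<bullet> (x - \<mu>)) * gauss z (x - \<mu>) \<partial>lborel)"
  shows "real (DIM('a) - 2) * \<psi> z \<mu> \<le> (B / z + \<epsilon> / (2 * z)) * (1 + real (DIM('a) - 2) * \<epsilon>)"
proof -
  define n where "n = DIM('a) - 2"
  define l where "l = 1 + \<epsilon>"
  have l: "1 < l" using \<epsilon> by (simp add: l_def)
  have dn: "DIM('a) = n + 2" using dim by (simp add: n_def)
  let ?I = "\<lambda>x. \<eta> x * gauss z (l *\<^sub>R x - \<mu>)"
  have "ennreal (l ^ (n + 2)) * (\<integral>\<^sup>+x. ennreal (?I x) \<partial>lborel)
     = (\<integral>\<^sup>+y. ennreal (h ((norm y)\<^sup>2 / l\<^sup>2) * gauss z (y - \<mu>)) \<partial>(lborel :: 'a measure))"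
    using l by (subst (2) nn_integral_lborel_affine[of _ l 0]) (simp_all add: dn power_mult_distrib)
  also have "\<dots> \<le> (\<integral>\<^sup>+y. ennreal (l\<^sup>2) * (ennreal (\<eta> y) * ennreal (gauss z (y - \<mu>))) \<partial>lborel)"
  proof (rule nn_integral_mono_AE)
    show "AE y in lborel. ennreal (h ((norm y)\<^sup>2 / l\<^sup>2) * gauss z (y - \<mu>))
       \<le> ennreal (l\<^sup>2) * (ennreal (\<eta> y) * ennreal (gauss z (y - \<mu>)))"
      using AE_lborel_singleton[of "0::'a"]
    proof eventually_elim
      case (elim y)
      have "1 \<le> l\<^sup>2" using l by (simp add: one_le_power)
      then have "(norm y)\<^sup>2 / l\<^sup>2 \<le> (norm y)\<^sup>2"
        using l by (simp add: divide_le_eq mult_le_cancel_left1)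
      then have "(norm y)\<^sup>2 / l\<^sup>2 * h ((norm y)\<^sup>2 / l\<^sup>2) \<le> (norm y)\<^sup>2 * \<eta> y"
        using elim l by (intro r_mono) auto
      then have "(norm y)\<^sup>2 * h ((norm y)\<^sup>2 / l\<^sup>2) \<le> (norm y)\<^sup>2 * (l\<^sup>2 * \<eta> y)"
        using l by (simp add: divide_le_eq mult_ac)
      then have "h ((norm y)\<^sup>2 / l\<^sup>2) \<le> l\<^sup>2 * \<eta> y" using elim by simp
      then have "h ((norm y)\<^sup>2 / l\<^sup>2) * gauss z (y - \<mu>) \<le> (l\<^sup>2 * \<eta> y) * gauss z (y - \<mu>)"
        by (rule mult_right_mono) simp
      then show ?case by (simp add: ennreal_leI mult.assoc flip: ennreal_mult)
    qed
  qed
  also have "\<dots> = ennreal (l\<^sup>2 * \<psi> z \<mu>)"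
    by (subst nn_integral_cmult) (simp_all add: psi[OF z] ennreal_mult)
  finally have dil: "ennreal (l ^ (n + 2)) * (\<integral>\<^sup>+x. ennreal (?I x) \<partial>lborel) \<le> ennreal (l\<^sup>2 * \<psi> z \<mu>)" .
  then have "ennreal (l ^ (n + 2)) * (\<integral>\<^sup>+x. ennreal (?I x) \<partial>lborel) < \<infinity>"
    by (rule le_less_trans) simp
  then have "(\<integral>\<^sup>+x. ennreal (?I x) \<partial>lborel) < \<infinity>"
  proof -
    have "0 < l * (l * l ^ n)" using l by simp
    then show ?thesis
      using \<open>ennreal (l ^ (n + 2)) * (\<integral>\<^sup>+x. ennreal (?I x) \<partial>lborel) < \<infinity>\<close>
      by (auto simp: ennreal_mult_less_top ennreal_eq_0_iff)
  qed
  then have int: "integrable lborel ?I"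
    by (intro integrableI_nonneg) auto
  define I where "I = (\<integral>x. ?I x \<partial>lborel)"
  have I: "0 \<le> I" "(\<integral>\<^sup>+x. ennreal (?I x) \<partial>lborel) = ennreal I"
    unfolding I_def by (simp_all add: nn_integral_eq_integral[OF int])
  have "l ^ (n + 2) * I \<le> l\<^sup>2 * \<psi> z \<mu>"
    using dil l psi(3)[OF z, of \<mu>] unfolding I by (simp add: I ennreal_le_iff flip: ennreal_mult)
  then have "l\<^sup>2 * (l ^ n * I) \<le> l\<^sup>2 * \<psi> z \<mu>"
    by (simp add: power_add power2_eq_square mult_ac)
  then have upper: "l ^ n * I \<le> \<psi> z \<mu>"
    using l by simp
  have pw: "\<eta> x * gauss z (x - \<mu>)
      - (\<epsilon> / z * (\<eta> x * (x \<bullet> (x - \<mu>)) * gauss z (x - \<mu>)) + \<epsilon>\<^sup>2 / (2 * z) * gauss z (x - \<mu>)) \<le> ?I x" for x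
  proof -
    let ?g = "gauss z (x - \<mu>)"
    have lx: "l *\<^sub>R x - \<mu> = (x - \<mu>) + \<epsilon> *\<^sub>R x" by (simp add: l_def algebra_simps)
    have sq: "(norm (l *\<^sub>R x - \<mu>))\<^sup>2 = (norm (x - \<mu>))\<^sup>2 + 2 * \<epsilon> * (x \<bullet> (x - \<mu>)) + \<epsilon>\<^sup>2 * (norm x)\<^sup>2"
      unfolding lx power2_norm_eq_inner
      by (simp only: inner_add_left inner_add_right inner_scaleR_left inner_scaleR_right
          inner_commute[of "x - \<mu>" x]) (simp add: power2_eq_square distrib_left)
    have "?g - ((norm (l *\<^sub>R x - \<mu>))\<^sup>2 - (norm (x - \<mu>))\<^sup>2) * (?g / (2 * z)) \<le> gauss z (l *\<^sub>R x - \<mu>)"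
      using gauss_tangent(1)[OF z, of "x - \<mu>" "l *\<^sub>R x - \<mu>"] by (simp add: algebra_simps)
    then have "\<eta> x * (?g - (2 * \<epsilon> * (x \<bullet> (x - \<mu>)) + \<epsilon>\<^sup>2 * (norm x)\<^sup>2) * (?g / (2 * z))) \<le> ?I x"
      unfolding sq by (intro mult_left_mono) (simp_all add: add.assoc)
    moreover have "\<eta> x * (?g - (2 * \<epsilon> * (x \<bullet> (x - \<mu>)) + \<epsilon>\<^sup>2 * (norm x)\<^sup>2) * (?g / (2 * z)))
      = \<eta> x * ?g - (\<epsilon> / z * (\<eta> x * (x \<bullet> (x - \<mu>)) * ?g) + ((norm x)\<^sup>2 * \<eta> x) * (\<epsilon>\<^sup>2 / (2 * z) * ?g))"
      using z by (simp add: field_simps)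
    moreover have "((norm x)\<^sup>2 * \<eta> x) * (\<epsilon>\<^sup>2 / (2 * z) * ?g) \<le> 1 * (\<epsilon>\<^sup>2 / (2 * z) * ?g)"
      using r_norm_le_1[of x] z by (intro mult_right_mono) auto
    ultimately show ?thesis by linarith
  qed
  have g1: "integrable lborel (\<lambda>x. gauss z (x - \<mu>))" "(\<integral>x. gauss z (x - \<mu>) \<partial>lborel) = 1"
  proof -
    show "integrable lborel (\<lambda>x. gauss z (x - \<mu>))"
      by (rule integrableI_nonneg) (auto simp: nn_integral_gauss[OF z])
    show "(\<integral>x. gauss z (x - \<mu>) \<partial>lborel) = 1"
      by (subst integral_eq_nn_integral) (auto simp: nn_integral_gauss[OF z])
  qed
  have "\<psi> z \<mu> - (\<epsilon> / z * B + \<epsilon>\<^sup>2 / (2 * z) * 1)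
      = (\<integral>x. \<eta> x * gauss z (x - \<mu>)
      - (\<epsilon> / z * (\<eta> x * (x \<bullet> (x - \<mu>)) * gauss z (x - \<mu>)) + \<epsilon>\<^sup>2 / (2 * z) * gauss z (x - \<mu>)) \<partial>lborel)"
    unfolding \<psi>_def B_def g1(2)[symmetric]
    using psi(1)[OF z, of \<mu>] stein_integrable(2)[OF z, of \<mu>] g1(1)
    by (simp only: Bochner_Integration.integral_diff Bochner_Integration.integral_add
        Bochner_Integration.integrable_add integrable_mult_right integral_mult_right_zero)
  also have "\<dots> \<le> I"
    unfolding I_def
    using psi(1)[OF z, of \<mu>] stein_integrable(2)[OF z, of \<mu>] g1(1) int
    by (intro integral_mono pw Bochner_Integration.integrable_diff Bochner_Integration.integrable_add
        integrable_mult_right)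
  finally have lower: "\<psi> z \<mu> \<le> I + \<epsilon> * (B / z + \<epsilon> / (2 * z))"
    by (simp add: power2_eq_square distrib_left)
  \<comment> \<open>Bernoulli's inequality turns the dilation factor into a rational one, which is linear to first
    order.\<close>
  have bern: "1 + real n * \<epsilon> \<le> l ^ n"
    using Bernoulli_inequality[of \<epsilon> n] \<epsilon> by (simp add: l_def)
  then have "(1 + real n * \<epsilon>) * I \<le> \<psi> z \<mu>"
    using upper I by (meson mult_right_mono order_trans)
  moreover have "(1 + real n * \<epsilon>) * \<psi> z \<mu> \<le> (1 + real n * \<epsilon>) * (I + \<epsilon> * (B / z + \<epsilon> / (2 * z)))"
    using lower \<epsilon> by (intro mult_left_mono) auto
  ultimately have "\<epsilon> * (real n * \<psi> z \<mu>) \<le> \<epsilon> * ((B / z + \<epsilon> / (2 * z)) * (1 + real n * \<epsilon>))"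
    by (simp add: algebra_simps)
  then show ?thesis using \<epsilon> by (simp add: n_def)
qed

text \<open>The limit \<open>\<epsilon> \<rightarrow> 0\<close>. For smooth \<open>h\<close> it is Stein's identity with the nonnegative term
  containing the derivative of \<open>t * h t\<close> dropped.\<close>

lemma stein_inequality:
  fixes \<mu> :: 'a
  assumes z: "0 < z"
  shows "z * (real (DIM('a) - 2) * \<psi> z \<mu>) \<le> (\<integral>x. \<eta> x * (x \<bullet> (x - \<mu>)) * gauss z (x - \<mu>) \<partial>lborel)"
proof -
  define B where "B = (\<integral>x. \<eta> x * (x \<bullet> (x - \<mu>)) * gauss z (x - \<mu>) \<partial>lborel)"
  have "((\<lambda>\<epsilon>. (B / z + \<epsilon> / (2 * z)) * (1 + real (DIM('a) - 2) * \<epsilon>))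
      \<longlongrightarrow> (B / z + 0 / (2 * z)) * (1 + real (DIM('a) - 2) * 0)) (at_right 0)"
    by (intro tendsto_intros) (use z in auto)
  moreover have "\<forall>\<^sub>F \<epsilon> in at_right 0. real (DIM('a) - 2) * \<psi> z \<mu>
      \<le> (B / z + \<epsilon> / (2 * z)) * (1 + real (DIM('a) - 2) * \<epsilon>)"
    using eventually_at_right_less[of "0::real"]
    by eventually_elim (unfold B_def, rule stein_dilation[OF z])
  ultimately have "real (DIM('a) - 2) * \<psi> z \<mu> \<le> (B / z + 0 / (2 * z)) * (1 + real (DIM('a) - 2) * 0)"
    by (rule tendsto_lowerbound) simp
  then show ?thesis using z unfolding B_def[symmetric] by (simp add: pos_le_divide_eq mult.commute)
qed

lemma gauss_risk_le:
  fixes \<mu> :: 'a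
  assumes z: "0 < z" and a: "0 < a"
    and M: "(\<integral>\<^sup>+x. ennreal ((norm (x - \<mu>))\<^sup>2) * ennreal (gauss z (x - \<mu>)) \<partial>lborel) = ennreal (z * M)" "0 \<le> M"
  shows "\<exists>R. 0 \<le> R \<and> R \<le> z * M - a * (2 * real (DIM('a) - 2) - a / z) * (z * \<psi> z \<mu>) \<and>
    (\<integral>\<^sup>+x. ennreal ((norm (x - (a * \<eta> x) *\<^sub>R x - \<mu>))\<^sup>2) * ennreal (gauss z (x - \<mu>)) \<partial>lborel) = ennreal R"
proof -
  let ?g = "\<lambda>x. gauss z (x - \<mu>)"
  let ?L = "\<lambda>x. (norm (x - (a * \<eta> x) *\<^sub>R x - \<mu>))\<^sup>2 * ?g x"
  let ?U = "\<lambda>x. (norm (x - \<mu>))\<^sup>2 * ?g x - 2 * a * (\<eta> x * (x \<bullet> (x - \<mu>)) * ?g x) + a\<^sup>2 * (\<eta> x * ?g x)"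
  note int = stein_integrable[OF z, of \<mu>] psi(1)[OF z, of \<mu>]
  have U: "integrable lborel ?U"
    using int by simp
  have LU: "?L x \<le> ?U x" for x
  proof -
    have e: "x - (a * \<eta> x) *\<^sub>R x - \<mu> = (x - \<mu>) - (a * \<eta> x) *\<^sub>R x" by simp
    have sq: "(norm (u - c *\<^sub>R x))\<^sup>2 = (norm u)\<^sup>2 - 2 * c * (x \<bullet> u) + c\<^sup>2 * (norm x)\<^sup>2" for u c
      unfolding power2_norm_eq_inner
      by (simp add: inner_diff_left inner_diff_right inner_commute[of u x] power2_eq_square
          right_diff_distrib)
    have "(norm (x - (a * \<eta> x) *\<^sub>R x - \<mu>))\<^sup>2
      = (norm (x - \<mu>))\<^sup>2 - 2 * a * (\<eta> x * (x \<bullet> (x - \<mu>))) + a\<^sup>2 * (\<eta> x * ((norm x)\<^sup>2 * \<eta> x))"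
      unfolding e sq by (simp add: power2_eq_square)
    also have "\<dots> \<le> (norm (x - \<mu>))\<^sup>2 - 2 * a * (\<eta> x * (x \<bullet> (x - \<mu>))) + a\<^sup>2 * \<eta> x"
      using r_norm_le_1[of x] by (intro add_left_mono mult_left_mono mult_left_le) auto
    finally have "?L x \<le> ((norm (x - \<mu>))\<^sup>2 - 2 * a * (\<eta> x * (x \<bullet> (x - \<mu>))) + a\<^sup>2 * \<eta> x) * ?g x"
      by (rule mult_right_mono) simp
    also have "\<dots> = ?U x" by (simp add: algebra_simps)
    finally show ?thesis .
  qed
  have L: "integrable lborel ?L"
  proof (rule Bochner_Integration.integrable_bound[OF U])
    have "norm (?L x) \<le> norm (?U x)" for x
    proof -
      have "0 \<le> ?L x" by simp
      then show ?thesis using LU[of x] by (simp only: real_norm_def abs_of_nonneg order_trans[OF _ LU])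
    qed
    then show "AE x in lborel. norm (?L x) \<le> norm (?U x)" by (rule AE_I2)
  qed measurable
  have zM: "(\<integral>x. (norm (x - \<mu>))\<^sup>2 * ?g x \<partial>lborel) = z * M"
  proof -
    have "(\<integral>\<^sup>+x. ennreal ((norm (x - \<mu>))\<^sup>2 * ?g x) \<partial>lborel) = ennreal (z * M)"
      using M(1) by (simp add: ennreal_mult')
    then show ?thesis using M(2) z by (subst integral_eq_nn_integral) simp_all
  qed
  have "(\<integral>x. ?L x \<partial>lborel) \<le> (\<integral>x. ?U x \<partial>lborel)"
    by (intro integral_mono L U LU)
  also have "\<dots> = z * M - 2 * a * (\<integral>x. \<eta> x * (x \<bullet> (x - \<mu>)) * ?g x \<partial>lborel) + a\<^sup>2 * \<psi> z \<mu>"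
    using int by (simp add: zM \<psi>_def)
  also have "\<dots> \<le> z * M - 2 * a * (z * (real (DIM('a) - 2) * \<psi> z \<mu>)) + a\<^sup>2 * \<psi> z \<mu>"
    using stein_inequality[OF z, of \<mu>] a by simp
  also have "\<dots> = z * M - a * (2 * real (DIM('a) - 2) - a / z) * (z * \<psi> z \<mu>)"
    using z by (simp add: field_simps power2_eq_square)
  finally have "(\<integral>x. ?L x \<partial>lborel) \<le> \<dots>" .
  moreover have "(\<integral>\<^sup>+x. ennreal ((norm (x - (a * \<eta> x) *\<^sub>R x - \<mu>))\<^sup>2) * ennreal (gauss z (x - \<mu>)) \<partial>lborel)
     = ennreal (\<integral>x. ?L x \<partial>lborel)"
    using nn_integral_eq_integral[OF L] by (simp add: ennreal_mult)
  moreover have "0 \<le> (\<integral>x. ?L x \<partial>lborel)" by simp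
  ultimately show ?thesis by blast
qed

end

section \<open>Baranchik estimators\<close>
context scale_mixture_model
begin

lemma sq_risk_iterated:
  assumes [measurable]: "m \<in> borel_measurable borel"
  shows "sq_risk m \<mu>
       = (\<integral>\<^sup>+z. \<integral>\<^sup>+x. ennreal ((norm (m x - \<mu>))\<^sup>2) * ennreal (gauss z (x - \<mu>)) \<partial>lborel \<partial>FZ)"
proof -
  note [measurable_cong] = positive_distributionD(4)[OF FZ_positive]
  interpret FZ: prob_space FZ by (rule positive_distributionD[OF FZ_positive])
  have "sq_risk m \<mu>
      = (\<integral>\<^sup>+x. \<integral>\<^sup>+z. ennreal ((norm (m x - \<mu>))\<^sup>2) * ennreal (gauss z (x - \<mu>)) \<partial>FZ \<partial>lborel)"
    unfolding sq_risk_def mix_def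
    by (rule nn_integral_cong, subst nn_integral_cmult) (simp_all add: mult.commute)
  also have "\<dots> = (\<integral>\<^sup>+z. \<integral>\<^sup>+x. ennreal ((norm (m x - \<mu>))\<^sup>2) * ennreal (gauss z (x - \<mu>)) \<partial>lborel \<partial>FZ)"
    by (rule nn_integral_swap) (unfold_locales, measurable)
  finally show ?thesis .
qed

text \<open>Let \<open>n = p - 2\<close>. Conditionally on \<open>Z = z\<close> the risk improves by at least \<open>a * (2 n - a / z) * (z * \<psi> z \<mu>)\<close>, which
  is negative for small \<open>z\<close>. Both factors depending on \<open>z\<close> increase, and the first changes sign at
  \<open>z0 = a / (2 n)\<close>, so the second may be replaced by its constant value \<open>\<kappa>\<close> at \<open>z0\<close>. What remains
  averages to a multiple of \<open>2 n - a * E (1 / Z)\<close>.\<close>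

lemma shrinkage_sq_risk_le:
  fixes h :: "real \<Rightarrow> real"
  assumes h: "shrinkage TYPE('a) h"
    and EZ: "integrable FZ (\<lambda>z. z)" and EZinv: "integrable FZ (\<lambda>z. 1 / z)"
    and a: "0 < a" "a * (\<integral>z. 1 / z \<partial>FZ) \<le> 2 * real (DIM('a) - 2)"
  shows "sq_risk (\<lambda>x. x - (a * h ((norm x)\<^sup>2)) *\<^sub>R x) \<mu> \<le> sq_risk (\<lambda>x. x) \<mu>"
proof -
  interpret shrinkage h "TYPE('a)" by (rule h)
  interpret FZ: prob_space FZ by (rule positive_distributionD[OF FZ_positive])
  note FZ_pos = positive_distributionD(5)[OF FZ_positive]
  obtain M where M: "0 \<le> M" "\<And>z (\<mu>::'a). 0 < z \<Longrightarrow>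
     (\<integral>\<^sup>+x. ennreal ((norm (x - \<mu>))\<^sup>2) * ennreal (gauss z (x - \<mu>)) \<partial>lborel) = ennreal (z * M)"
    using gauss_dispersion[where 'a = 'a] by blast
  define n where "n = real (DIM('a) - 2)"
  have n: "0 < n" using dim by (simp add: n_def)
  define z0 where "z0 = a / (2 * n)"
  have z0: "0 < z0" using a n by (simp add: z0_def)
  define \<kappa> where "\<kappa> = z0 * \<psi> z0 \<mu>"
  have \<kappa>: "0 \<le> \<kappa>" using z0 psi(3)[OF z0] by (simp add: \<kappa>_def)
  let ?U = "\<lambda>z. z * M - a * (2 * n - a / z) * \<kappa>"
  let ?m = "\<lambda>x. x - (a * h ((norm x)\<^sup>2)) *\<^sub>R x"
  have pw: "(\<integral>\<^sup>+x. ennreal ((norm (?m x - \<mu>))\<^sup>2) * ennreal (gauss z (x - \<mu>)) \<partial>lborel) \<le> ennreal (?U z) \<and> 0 \<le> ?U z"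
    if z: "0 < z" for z
  proof -
    obtain R where R: "0 \<le> R" "R \<le> z * M - a * (2 * n - a / z) * (z * \<psi> z \<mu>)"
      "(\<integral>\<^sup>+x. ennreal ((norm (?m x - \<mu>))\<^sup>2) * ennreal (gauss z (x - \<mu>)) \<partial>lborel) = ennreal R"
      using gauss_risk_le[OF z a(1) M(2)[OF z] M(1)] unfolding n_def by blast
    have "0 \<le> (2 * n - a / z) * (z * \<psi> z \<mu> - \<kappa>)"
    proof (cases "z0 \<le> z")
      case True
      then have "a / z \<le> 2 * n" using z n by (simp add: z0_def field_simps)
      moreover have "\<kappa> \<le> z * \<psi> z \<mu>" unfolding \<kappa>_def by (rule psi_scaled_mono[OF z0 True])
      ultimately show ?thesis by simp
    next
      case False
      then have "2 * n \<le> a / z" using z n by (simp add: z0_def field_simps)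
      moreover have "z * \<psi> z \<mu> \<le> \<kappa>" unfolding \<kappa>_def using False by (intro psi_scaled_mono[OF z]) simp
      ultimately show ?thesis by (simp add: mult_nonpos_nonpos)
    qed
    then have "0 \<le> a * ((2 * n - a / z) * (z * \<psi> z \<mu> - \<kappa>))"
      by (rule mult_nonneg_nonneg[OF less_imp_le[OF a(1)]])
    moreover have "a * (A * (P - k)) = a * A * P - a * A * k" for A P k :: real
      by (simp add: algebra_simps)
    ultimately have "R \<le> ?U z" using R(2) by simp
    then show ?thesis using R by (simp add: ennreal_leI)
  qed
  define c k where "c = a * (2 * n) * \<kappa>" and "k = a * a * \<kappa>"
  have U_eq: "?U = (\<lambda>z. z * M - (c - k * (1 / z)))"
    by (simp add: fun_eq_iff algebra_simps c_def k_def)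
  have i1: "integrable FZ (\<lambda>z. z * M)" and i2: "integrable FZ (\<lambda>z. k * (1 / z))"
    by (intro integrable_mult_left integrable_mult_right EZ EZinv)+
  have i3: "integrable FZ (\<lambda>z. c - k * (1 / z))"
    by (intro Bochner_Integration.integrable_diff i2) simp
  have U: "integrable FZ ?U"
    unfolding U_eq by (intro Bochner_Integration.integrable_diff i1 i3)
  have "sq_risk ?m \<mu> \<le> (\<integral>\<^sup>+z. ennreal (?U z) \<partial>FZ)"
    using FZ_pos by (subst sq_risk_iterated) (auto intro!: nn_integral_mono_AE elim!: eventually_mono simp: pw)
  also have "\<dots> = ennreal (\<integral>z. ?U z \<partial>FZ)"
  proof (rule nn_integral_eq_integral[OF U])
    show "AE z in FZ. 0 \<le> ?U z"
      using FZ_pos by eventually_elim (rule conjunct2[OF pw])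
  qed
  also have "(\<integral>z. ?U z \<partial>FZ) = (\<integral>z. z * M \<partial>FZ) - a * \<kappa> * (2 * n - a * (\<integral>z. 1 / z \<partial>FZ))"
  proof -
    have "(\<integral>z. ?U z \<partial>FZ) = (\<integral>z. z * M \<partial>FZ) - ((\<integral>z. c \<partial>FZ) - (\<integral>z. k * (1 / z) \<partial>FZ))"
      unfolding U_eq by (simp only: Bochner_Integration.integral_diff[OF i1 i3]
          Bochner_Integration.integral_diff[OF FZ.integrable_const i2])
    also have "(\<integral>z. k * (1 / z) \<partial>FZ) = k * (\<integral>z. 1 / z \<partial>FZ)"
      by (rule integral_mult_right_zero)
    also have "(\<integral>z. c \<partial>FZ) = c"
      using FZ.prob_space by simp
    finally have "(\<integral>z. ?U z \<partial>FZ) = (\<integral>z. z * M \<partial>FZ) - (c - k * (\<integral>z. 1 / z \<partial>FZ))" .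
    then show ?thesis by (simp only: c_def k_def) (simp add: algebra_simps)
  qed
  also have "ennreal \<dots> \<le> ennreal (\<integral>z. z * M \<partial>FZ)"
  proof (intro ennreal_leI)
    have "0 \<le> a * \<kappa> * (2 * n - a * (\<integral>z. 1 / z \<partial>FZ))"
      using a \<kappa> by (intro mult_nonneg_nonneg) (auto simp: n_def)
    then show "(\<integral>z. z * M \<partial>FZ) - a * \<kappa> * (2 * n - a * (\<integral>z. 1 / z \<partial>FZ)) \<le> (\<integral>z. z * M \<partial>FZ)"
      by simp
  qed
  also have "\<dots> = (\<integral>\<^sup>+z. ennreal (z * M) \<partial>FZ)"
    using EZ FZ_pos M(1) by (intro nn_integral_eq_integral[symmetric]) (auto elim!: eventually_mono)
  also have "\<dots> = sq_risk (\<lambda>x. x) \<mu>"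
    using FZ_pos by (subst sq_risk_iterated) (auto intro!: nn_integral_cong_AE elim!: eventually_mono simp: M(2))
  finally show ?thesis .
qed

lemma not_AE_norm_le: "\<not> (AE x::'a in lborel. norm x \<le> R)"
proof
  assume "AE x::'a in lborel. norm x \<le> R"
  then have "AE x::'a in lborel. x \<in> cball 0 R" by simp
  then have "emeasure lborel (UNIV :: 'a set) \<le> emeasure lborel (cball (0::'a) R)"
    by (intro emeasure_mono_AE) auto
  moreover have "emeasure lborel (cball (0::'a) R) < \<infinity>"
    by (intro emeasure_bounded_finite bounded_cball)
  ultimately show False by simp
qed

text \<open>The squared-error risks may coincide, as they do for the James-Stein estimator with the extreme
  constant when \<open>Z\<close> is degenerate. Strictness therefore comes from strict convexity at \<open>\<mu> = 0\<close>: far from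
  the origin the estimator is strictly shorter than the observation.\<close>

theorem baranchik_dominates:
  assumes EZ: "integrable FZ (\<lambda>z. z)" and EZinv: "integrable FZ (\<lambda>z. 1 / z)" and d: "3 \<le> DIM('a)"
    and r: "mono_on {0<..} r" "antimono_on {0<..} (\<lambda>t. r t / t)"
      "\<forall>t>0. 0 \<le> r t \<and> r t \<le> 1" "\<exists>t>0. r t \<noteq> 0"
    and a: "0 < a" "a * (\<integral>z. 1 / z \<partial>FZ) \<le> 2 * (real DIM('a) - 2)"
  shows "density_dominates q pX (\<lambda>y x. g (y - baranchik a r x)) (\<lambda>y x. g (y - x))"
proof -
  define h where "h t = (if 0 < t then r t / t else 0)" for t
  have h: "shrinkage TYPE('a) h"
  proof
    have "mono (\<lambda>t. if 0 < t then r t else 0)"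
      using r(1,3) by (intro monoI) (auto simp: monotone_on_def)
    then have [measurable]: "(\<lambda>t. if 0 < t then r t else 0) \<in> borel_measurable borel"
      by (rule borel_measurable_mono)
    have "h = (\<lambda>t. (if 0 < t then r t else 0) / t)" by (auto simp: h_def)
    then show "h \<in> borel_measurable borel" by simp
  next
    fix s t :: real
    show "0 \<le> h t" using r(3) by (simp add: h_def)
    show "h t \<le> h s" if "0 < s" "s \<le> t"
      using that r(2) by (simp add: h_def monotone_on_def)
    show "s * h s \<le> t * h t" if "0 < s" "s \<le> t"
      using that r(1) by (simp add: h_def monotone_on_def)
    show "t * h t \<le> 1" using r(3) by (simp add: h_def)
    show "3 \<le> DIM('a)" by (rule d)
  qed
  interpret shrinkage h "TYPE('a)" by (rule h)
  have bar: "baranchik a r = (\<lambda>x. x - (a * h ((norm x)\<^sup>2)) *\<^sub>R (x :: 'a))"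
    by (rule ext) (simp add: baranchik_def h_def power2_norm_eq_inner algebra_simps)
  have m [measurable]: "(baranchik a r :: 'a \<Rightarrow> 'a) \<in> borel_measurable borel"
    unfolding bar by measurable
  have le: "sq_risk (baranchik a r) \<mu> \<le> sq_risk (\<lambda>x. x) \<mu>" for \<mu>
    unfolding bar using a d by (intro shrinkage_sq_risk_le[OF h EZ EZinv]) (simp_all add: of_nat_diff)
  obtain t0 where t0: "0 < t0" "0 < r t0"
    using r(3,4) by (metis less_eq_real_def)
  have shrinks: "norm (baranchik a r x) < norm x" if "norm x > sqrt (max t0 a)" for x :: 'a
  proof -
    let ?t = "(norm x)\<^sup>2"
    have "max t0 a < ?t"
      using that by (metis real_sqrt_abs abs_norm_cancel real_sqrt_less_iff)
    then have t: "t0 < ?t" "a < ?t" by auto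
    then have "r t0 \<le> r ?t" using t0 by (intro monotone_onD[OF r(1)]) auto
    moreover have "0 < ?t" using t0 t by linarith
    ultimately have rt: "0 < ?t" "0 < r ?t" "r ?t \<le> 1" using t0 r(3) by force+
    then have "a * r ?t < ?t"
      using mult_left_le[of "r ?t" a] a(1) t(2) by linarith
    then have "0 < a * h ?t" "a * h ?t < 1"
      using a(1) rt by (simp_all add: h_def)
    then have "\<bar>1 - a * h ?t\<bar> < 1" by simp
    moreover have "0 < norm x" using that t0 by (meson le_less_trans real_sqrt_ge_zero max.coboundedI1 less_imp_le)
    ultimately have "\<bar>1 - a * h ?t\<bar> * norm x < 1 * norm x" by (intro mult_strict_right_mono)
    moreover have "baranchik a r x = (1 - a * h ?t) *\<^sub>R x" unfolding bar by (simp add: algebra_simps)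
    ultimately show ?thesis by simp
  qed
  have "\<not> (AE x in lborel. norm (baranchik a r x - 0) = norm (x - (0::'a)))"
  proof
    assume "AE x in lborel. norm (baranchik a r x - 0) = norm (x - (0::'a))"
    then have "AE x::'a in lborel. norm x \<le> sqrt (max t0 a)"
      by eventually_elim (metis diff_zero less_irrefl not_le shrinks)
    then show False using not_AE_norm_le by blast
  qed
  then show ?thesis
    unfolding density_dominates_iff_overlap[OF m measurable_ident_sets[OF refl]]
    using overlap_mono_sq_risk(1,3)[OF m le] by blast
qed

end

section \<open>The dominance theorem\<close>

theorem theorem4p1:
  fixes q p_X :: "'a::euclidean_space \<Rightarrow> real"
    and G H F J F_Z :: "real measure"
    and S :: "'w measure" and V1 W1 W2 :: "'w \<Rightarrow> real"
  assumes "scale_mixture_normal q H"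
    and "scale_mixture_normal p_X G"
    and "integrable G (\<lambda>v. v powr (- (real DIM('a) / 2)))"
    and "integrable H (\<lambda>w. w powr (- (real DIM('a) / 2)))"
    and "prob_space S"
    and "prob_space.indep_vars S (\<lambda>_. borel)
           (\<lambda>i::nat. if i = 0 then V1 else if i = 1 then W1 else W2) {0, 1, 2}"
    and "distr S borel V1 = G" and "distr S borel W1 = H" and "distr S borel W2 = H"
    and "F = distr S borel (\<lambda>\<omega>. V1 \<omega> + W1 \<omega>)"
    and "J = distr S borel (\<lambda>\<omega>. V1 \<omega> + W1 \<omega> + W2 \<omega>)"
    and "F_Z = Z_law DIM('a) G J"
  shows
    "scale_mixture_normal (convol q p_X) F
     \<and> is_MRE q p_X (\<lambda>y x. convol q p_X (y - x))
     \<and> (\<forall>m \<in> borel_measurable borel. \<forall>K::real.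
          density_dominates q p_X (\<lambda>y x. convol q p_X (y - m x)) (\<lambda>y x. convol q p_X (y - x))
          \<longleftrightarrow>
          point_dominates p_X
            (\<lambda>d \<mu>. K - (\<integral>t. (2 * pi * t) powr (- (real DIM('a) / 2))
                              * exp (- (norm (d - \<mu>))\<^sup>2 / (2 * t)) \<partial>J))
            m (\<lambda>x. x))
     \<and> (\<forall>m \<in> borel_measurable borel.
          point_dominates (sn_density F_Z) (\<lambda>d \<mu>. (norm (d - \<mu>))\<^sup>2) m (\<lambda>x. x)
          \<longrightarrow>
          density_dominates q p_X (\<lambda>y x. convol q p_X (y - m x)) (\<lambda>y x. convol q p_X (y - x)))
     \<and> (integrable F_Z (\<lambda>z. z) \<and> integrable F_Z (\<lambda>z. 1 / z) \<and> 3 \<le> DIM('a) \<longrightarrow>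
          density_inadmissible q p_X (\<lambda>y x. convol q p_X (y - x))
          \<and> (\<forall>a r. mono_on {0<..} r \<and> antimono_on {0<..} (\<lambda>t. r t / t)
                \<and> (\<forall>t>0. 0 \<le> r t \<and> r t \<le> 1) \<and> (\<exists>t>0. r t \<noteq> 0)
                \<and> 0 < a \<and> a \<le> 2 * (real DIM('a) - 2) / (\<integral>z. 1 / z \<partial>F_Z)
              \<longrightarrow> density_dominates q p_X
                    (\<lambda>y x. convol q p_X (y - baranchik a r x))
                    (\<lambda>y x. convol q p_X (y - x))))"
proof -
  interpret S: prob_space S by fact
  interpret M: scale_mixture_model q p_X G H
    by unfold_locales fact+
  \<comment> \<open>The laws of the sums of independent variables are the convolutions of the model.\<close>
  let ?X = "\<lambda>i::nat. if i = 0 then V1 else if i = 1 then W1 else W2"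
  have rv: "S.random_variable borel V1" "S.random_variable borel W1" "S.random_variable borel W2"
    using S.indep_vars_def2[THEN iffD1, OF assms(6)] by (auto dest: bspec split: if_splits)
  have "S.indep_vars (\<lambda>_. borel) ?X {0, 1}"
    using assms(6) by (rule S.indep_vars_subset) auto
  then have "S.indep_var borel (?X 0) borel (\<lambda>\<omega>. \<Sum>i\<in>{1}. ?X i \<omega>)"
    by (intro S.indep_vars_sum) auto
  then have VW: "S.indep_var borel V1 borel W1" by simp
  have "{0, 1, 2} = insert 2 {0, 1 :: nat}" by auto
  then have "S.indep_var borel (?X 2) borel (\<lambda>\<omega>. \<Sum>i\<in>{0, 1}. ?X i \<omega>)"
    using assms(6) by (intro S.indep_vars_sum) auto
  then have WVW: "S.indep_var borel W2 borel (\<lambda>\<omega>. V1 \<omega> + W1 \<omega>)" by simp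
  have F: "F = M.F"
    using S.sum_indep_random_variable[OF VW rv(1,2)] assms by (simp add: M.F_def)
  have J: "J = M.J"
  proof -
    have "J = distr S borel (\<lambda>\<omega>. W2 \<omega> + (V1 \<omega> + W1 \<omega>))"
      using assms by (simp add: add_ac)
    also have "\<dots> = (H \<star> F)"
      using S.sum_indep_random_variable[OF WVW rv(3)] rv assms by simp
    also have "\<dots> = (F \<star> H)"
      using positive_distributionD(3,4)[OF M.pos_H] positive_distributionD(3,4)[OF M.pos_F]
      by (intro convolution_commutative) (simp_all add: F)
    finally show ?thesis by (simp add: M.J_def F)
  qed
  have FZ: "F_Z = M.FZ" using assms by (simp add: M.FZ_def J)
  have loss: "(\<lambda>d \<mu>. K - (\<integral>t. (2 * pi * t) powr (- (real DIM('a) / 2)) * exp (- (norm (d - \<mu>))\<^sup>2 / (2 * t)) \<partial>J))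
    = (\<lambda>d \<mu> :: 'a. K - sn_density M.J (d - \<mu>))" for K
    by (simp add: sn_density_def J)
  have c: "density_inadmissible q p_X (\<lambda>y x. M.g (y - x))
      \<and> (\<forall>a r. mono_on {0<..} r \<and> antimono_on {0<..} (\<lambda>t. r t / t)
            \<and> (\<forall>t>0. 0 \<le> r t \<and> r t \<le> 1) \<and> (\<exists>t>0. r t \<noteq> 0)
            \<and> 0 < a \<and> a \<le> 2 * (real DIM('a) - 2) / (\<integral>z. 1 / z \<partial>M.FZ)
          \<longrightarrow> density_dominates q p_X (\<lambda>y x. M.g (y - baranchik a r x)) (\<lambda>y x. M.g (y - x)))"
    if EZ: "integrable M.FZ (\<lambda>z. z)" and EZinv: "integrable M.FZ (\<lambda>z. 1 / z)" and d: "3 \<le> DIM('a)"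
  proof -
    interpret FZ: prob_space M.FZ by (rule positive_distributionD[OF M.FZ_positive])
    have "0 < (\<integral>z. 1 / z \<partial>M.FZ)"
      using EZinv positive_distributionD(5)[OF M.FZ_positive]
      by (intro FZ.expectation_greater) (auto elim!: eventually_mono)
    then have dom: "density_dominates q p_X (\<lambda>y x. M.g (y - baranchik a r x)) (\<lambda>y x. M.g (y - x))"
      if "mono_on {0<..} r" "antimono_on {0<..} (\<lambda>t. r t / t)" "\<forall>t>0. 0 \<le> r t \<and> r t \<le> 1"
        "\<exists>t>0. r t \<noteq> 0" "0 < a" "a \<le> 2 * (real DIM('a) - 2) / (\<integral>z. 1 / z \<partial>M.FZ)" for a r
      using that by (intro M.baranchik_dominates EZ EZinv d) (simp_all add: pos_le_divide_eq)
    \<comment> \<open>The James-Stein choice \<open>r = 1\<close> with the largest admissible constant witnesses inadmissibility.\<close>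
    have "density_dominates q p_X
        (\<lambda>y x. M.g (y - baranchik (2 * (real DIM('a) - 2) / (\<integral>z. 1 / z \<partial>M.FZ)) (\<lambda>_. 1) x)) (\<lambda>y x. M.g (y - x))"
      using \<open>0 < (\<integral>z. 1 / z \<partial>M.FZ)\<close> d
      by (intro dom) (auto simp: monotone_on_def intro!: divide_left_mono divide_pos_pos exI[of _ 1])
    then show ?thesis unfolding density_inadmissible_def using dom by blast
  qed
  show ?thesis
    unfolding F FZ loss M.g_def[symmetric]
    using M.g_smn M.g_is_MRE M.dominance_iff_point_dominance M.squared_error_dominance_transfers c
    by blast
qed

end
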